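(* Let $m\ge 1$ be an integer and $q\in(1,m+1]$. The following conditions are equivalent: (i) $q\in\mathcal B_2(m)$; (ii) $1\in\mathcal U_q-\mathcal U_q$; (iii) $1\in\overline{\mathcal U_q}-\overline{\mathcal U_q}$; (iv) $1\in\mathcal V_q-\mathcal V_q$ and $q\neq\mathcal G(m)$.
   Context: Let $\Omega_m=\{0,1,\dots,m\}$. For $q\in(1,m+1]$ put $I_q=[0,\frac{m}{q-1}]$. A $q$-expansion of $x\in I_q$ is a sequence $(c_i)\in\Omega_m^{\mathbb N}$ with $x=\sum_{i\ge1}c_iq^{-i}$. A sequence is infinite if it has infinitely many nonzero terms. The reflection of $(a_i)$ is $(m-a_i)$; a $q$-expansion $(a_i)$ is doubly infinite if both $(a_i)$ and its reflection are infinite. $\mathcal U_q$ is the set of $x\in I_q$ having a unique $q$-expansion; $\overline{\mathcal U_q}$ is its closure; $\mathcal V_q$ is the set of $x\in I_q$ having at most one doubly infinite $q$-expansion. For $A\subset\mathbb R$, $A-A=\{a-b:a,b\in A\}$. $\mathcal B_2(m)$ is the set of $q\in(1,m+1]$ such that some $x\in I_q$ has exactly two different $q$-expansions. The generalized golden ratio is $\mathcal G(m)=k+1$ if $m=2k$ ($k\ge1$) and $\mathcal G(m)=\frac{k+1+\sqrt{k^2+6k+5}}{2}$ if $m=2k+1$ ($k\ge0$). *)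

theory Defs
  imports "HOL-Analysis.Analysis"
begin

definition I_q :: "nat \<Rightarrow> real \<Rightarrow> real set" where
  "I_q m q = {0 .. real m / (q - 1)}"

text \<open>Sequences \<open>(c\<^sub>i)\<close> with \<open>i \<ge> 1\<close> are represented as functions on \<^typ>\<open>nat\<close>
  starting at index 0, so \<open>c i\<close> is the digit of weight \<open>q\<close> to the power \<open>-(i + 1)\<close>.\<close>

definition is_expansion :: "nat \<Rightarrow> real \<Rightarrow> real \<Rightarrow> (nat \<Rightarrow> nat) \<Rightarrow> bool" where
  "is_expansion m q x c \<longleftrightarrow>
     (\<forall>i. c i \<in> {0..m}) \<and> (\<lambda>i. real (c i) / q ^ Suc i) sums x"

definition infinite_seq :: "(nat \<Rightarrow> nat) \<Rightarrow> bool" where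
  "infinite_seq c \<longleftrightarrow> infinite {i. c i \<noteq> 0}"

text \<open>The natural-number subtraction does not truncate on digits in \<open>{0..m}\<close>.\<close>

definition reflection :: "nat \<Rightarrow> (nat \<Rightarrow> nat) \<Rightarrow> (nat \<Rightarrow> nat)" where
  "reflection m c = (\<lambda>i. m - c i)"

definition doubly_infinite :: "nat \<Rightarrow> (nat \<Rightarrow> nat) \<Rightarrow> bool" where
  "doubly_infinite m c \<longleftrightarrow> infinite_seq c \<and> infinite_seq (reflection m c)"

definition U_q :: "nat \<Rightarrow> real \<Rightarrow> real set" where
  "U_q m q = {x \<in> I_q m q. \<exists>!c. is_expansion m q x c}"

definition V_q :: "nat \<Rightarrow> real \<Rightarrow> real set" where
  "V_q m q = {x \<in> I_q m q. \<exists>\<^sub>\<le>\<^sub>1c. is_expansion m q x c \<and> doubly_infinite m c}"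

text \<open>Algebraic difference, not to be confused with the set difference \<open>A - B\<close>.\<close>

definition diff_set :: "real set \<Rightarrow> real set \<Rightarrow> real set" where
  "diff_set A B = {a - b | a b. a \<in> A \<and> b \<in> B}"

definition B2 :: "nat \<Rightarrow> real set" where
  "B2 m = {q \<in> {1 <.. real m + 1}. \<exists>x \<in> I_q m q. card {c. is_expansion m q x c} = 2}"

definition golden :: "nat \<Rightarrow> real" where
  "golden m = (let k = real (m div 2) in
     if even m then k + 1 else (k + 1 + sqrt (k\<^sup>2 + 6 * k + 5)) / 2)"

end

theory Submission
  imports Defs
begin

text \<open>Write \<open>M = m / (q - 1)\<close>. Two expansions of one number with exactly two expansions part at
  some digit, and their tails after it are elements of \<open>U_q\<close> differing by 1; this gives
  (i) \<open>\<longleftrightarrow>\<close> (ii). Since \<open>closure U_q \<subseteq> V_q\<close>, the remaining point is (iv) \<open>\<longrightarrow>\<close> (ii).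
  If \<open>V_q \<noteq> U_q\<close>, then some tail of an element of \<open>V_q - U_q\<close>, up to reflection, is the
  quasi-greedy expansion \<open>\<alpha>\<close> of 1, and \<open>1 \<in> V_q\<close>. Either \<open>1 \<in> U_q\<close>, and then \<open>1 = 1 - 0\<close>
  is the desired difference, or \<open>\<alpha>\<close> equals one of its own tails or the reflection of one,
  hence is periodic with some period \<open>N\<close>, and \<open>\<alpha>\<^sub>1 \<dots> \<alpha>\<^sub>N\<^sub>-\<^sub>1 (\<alpha>\<^sub>N + 1) 0 0 \<dots>\<close> is a finite
  expansion of 1. Lowering the last digit of a suitable prefix of \<open>\<alpha>\<close> and repeating it
  periodically gives a sequence whose reflection \<open>d\<close> can be appended both to
  \<open>\<alpha>\<^sub>1 \<dots> (\<alpha>\<^sub>N + 1)\<close> and to \<open>0 \<dots> 0\<close> so that both results are unique expansions; their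
  values differ by 1. Only for the generalized golden ratio does no such prefix exist.\<close>

subsection \<open>Sequences and their lexicographic order\<close>

definition shift :: "nat \<Rightarrow> (nat \<Rightarrow> nat) \<Rightarrow> nat \<Rightarrow> nat" where
  "shift k c = (\<lambda>i. c (k + i))"

definition prepend :: "nat \<Rightarrow> (nat \<Rightarrow> nat) \<Rightarrow> (nat \<Rightarrow> nat) \<Rightarrow> nat \<Rightarrow> nat" where
  "prepend n a d = (\<lambda>i. if i < n then a i else d (i - n))"

definition digits :: "nat \<Rightarrow> (nat \<Rightarrow> nat) \<Rightarrow> bool" where
  "digits m c \<longleftrightarrow> (\<forall>i. c i \<le> m)"

definition lex_at :: "nat \<Rightarrow> (nat \<Rightarrow> nat) \<Rightarrow> (nat \<Rightarrow> nat) \<Rightarrow> bool" where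
  "lex_at k x y \<longleftrightarrow> (\<forall>i<k. x i = y i) \<and> x k < y k"

definition lex_less :: "(nat \<Rightarrow> nat) \<Rightarrow> (nat \<Rightarrow> nat) \<Rightarrow> bool"  (infix "<\<^sub>l" 50) where
  "x <\<^sub>l y \<longleftrightarrow> (\<exists>k. lex_at k x y)"

definition lex_le :: "(nat \<Rightarrow> nat) \<Rightarrow> (nat \<Rightarrow> nat) \<Rightarrow> bool"  (infix "\<le>\<^sub>l" 50) where
  "x \<le>\<^sub>l y \<longleftrightarrow> x <\<^sub>l y \<or> x = y"

lemma shift_0 [simp]: "shift 0 c = c"
  by (simp add: shift_def)

lemma shift_shift [simp]: "shift j (shift k c) = shift (k + j) c"
  by (simp add: shift_def add.assoc)

lemma shift_apply [simp]: "shift k c i = c (k + i)"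
  by (simp add: shift_def)

lemma reflection_apply [simp]: "reflection m c i = m - c i"
  by (simp add: reflection_def)

lemma reflection_shift: "reflection m (shift k c) = shift k (reflection m c)"
  by (simp add: reflection_def shift_def)

lemma reflection_reflection [simp]: "digits m c \<Longrightarrow> reflection m (reflection m c) = c"
  by (auto simp: reflection_def digits_def)

lemma digits_reflection [simp]: "digits m (reflection m c)"
  by (simp add: digits_def)

lemma digits_shift [simp]: "digits m c \<Longrightarrow> digits m (shift k c)"
  by (simp add: digits_def)

lemma digits_prepend: "(\<And>i. i < n \<Longrightarrow> a i \<le> m) \<Longrightarrow> digits m d \<Longrightarrow> digits m (prepend n a d)"
  by (simp add: digits_def prepend_def)

lemma digits_case_nat: "e \<le> m \<Longrightarrow> digits m d \<Longrightarrow> digits m (case_nat e d)"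
  by (simp add: digits_def split: nat.split)

lemma shift_prepend_ge: "n \<le> k \<Longrightarrow> shift k (prepend n a d) = shift (k - n) d"
  by (auto simp: prepend_def shift_def)

lemma shift_prepend_le: "k \<le> n \<Longrightarrow> shift k (prepend n a d) = prepend (n - k) (shift k a) d"
  by (auto simp: prepend_def shift_def fun_eq_iff intro!: arg_cong[of _ _ d])

lemma lex_antisym: "x <\<^sub>l y \<Longrightarrow> \<not> y \<le>\<^sub>l x"
proof
  assume "x <\<^sub>l y" "y \<le>\<^sub>l x"
  then obtain k where k: "lex_at k x y" by (auto simp: lex_less_def)
  from \<open>y \<le>\<^sub>l x\<close> k have "y <\<^sub>l x" by (auto simp: lex_le_def lex_at_def)
  then obtain l where "lex_at l y x" by (auto simp: lex_less_def)
  with k show False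
    by (cases k l rule: linorder_cases) (auto simp: lex_at_def)
qed

lemma lex_lessI: "(\<And>i. i < k \<Longrightarrow> x i = y i) \<Longrightarrow> x k < y k \<Longrightarrow> x <\<^sub>l y"
  by (auto simp: lex_less_def lex_at_def)

lemma lex_total: "x \<le>\<^sub>l y \<or> y <\<^sub>l x"
proof (cases "x = y")
  case False
  then have ex: "\<exists>k. x k \<noteq> y k" by auto
  define k where "k = (LEAST k. x k \<noteq> y k)"
  have "x k \<noteq> y k" unfolding k_def using ex by (rule LeastI_ex)
  moreover have "\<forall>i<k. x i = y i" unfolding k_def using not_less_Least by blast
  ultimately show ?thesis
    unfolding lex_le_def lex_less_def lex_at_def by (metis linorder_neqE_nat)
qed (simp add: lex_le_def)

lemma lex_prefix:
  assumes "x \<le>\<^sub>l y"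
  obtains k where "k < N" "lex_at k x y" | "\<And>i. i < N \<Longrightarrow> x i = y i"
  using assms unfolding lex_le_def lex_less_def lex_at_def
  by (metis not_le order_less_le_trans)

lemma lex_drop: "x <\<^sub>l y \<Longrightarrow> (\<And>i. i < N \<Longrightarrow> x i = y i) \<Longrightarrow> shift N x <\<^sub>l shift N y"
proof -
  assume "x <\<^sub>l y" and eq: "\<And>i. i < N \<Longrightarrow> x i = y i"
  then obtain k where k: "lex_at k x y" by (auto simp: lex_less_def)
  then have "N \<le> k" using eq by (auto simp: lex_at_def not_less[symmetric])
  with k show ?thesis by (intro lex_lessI[of "k - N"]) (auto simp: lex_at_def)
qed

lemma lex_append: "(\<And>i. i < N \<Longrightarrow> x i = y i) \<Longrightarrow> shift N x <\<^sub>l shift N y \<Longrightarrow> x <\<^sub>l y"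
proof -
  assume eq: "\<And>i. i < N \<Longrightarrow> x i = y i" and "shift N x <\<^sub>l shift N y"
  then obtain k where k: "lex_at k (shift N x) (shift N y)" by (auto simp: lex_less_def)
  show ?thesis
  proof (rule lex_lessI[of "N + k"])
    show "x i = y i" if "i < N + k" for i
    proof (cases "i < N")
      case False
      then have "i - N < k" using that by simp
      then have "x (N + (i - N)) = y (N + (i - N))" using k unfolding lex_at_def by (simp del: add_diff_inverse)
      with False show ?thesis by simp
    qed (simp add: eq)
  qed (use k in \<open>simp add: lex_at_def\<close>)
qed

lemma lex_first: "x \<le>\<^sub>l y \<Longrightarrow> (\<And>i. i < N \<Longrightarrow> x i = y i) \<Longrightarrow> x N \<le> y N"
  unfolding lex_le_def lex_less_def lex_at_def
  by (metis linorder_neqE_nat nat_less_le order_refl)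

lemma lex_reflection_swap:
  assumes "digits m x" "digits m y" "lex_at k (reflection m x) y"
  shows "lex_at k (reflection m y) x"
proof -
  have "m - y i = x i" if "i < k" for i
    using assms that unfolding lex_at_def digits_def reflection_apply by (metis diff_diff_cancel)
  moreover have "m - y k < x k" using assms unfolding lex_at_def digits_def reflection_apply
    by (metis add.commute less_diff_conv2)
  ultimately show ?thesis by (simp add: lex_at_def)
qed

text \<open>With \<open>\<alpha>\<close> the quasi-greedy expansion of 1, these are the lexicographic counterparts of
  \<open>1 \<in> V_q\<close> and of \<open>c\<close> being a unique expansion.\<close>

definition quasi_admissible :: "nat \<Rightarrow> (nat \<Rightarrow> nat) \<Rightarrow> bool" where
  "quasi_admissible m \<alpha> \<longleftrightarrow> digits m \<alpha> \<and>
     (\<forall>n. (\<alpha> n < m \<longrightarrow> shift (Suc n) \<alpha> \<le>\<^sub>l \<alpha>) \<and>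
          (0 < \<alpha> n \<longrightarrow> reflection m (shift (Suc n) \<alpha>) \<le>\<^sub>l \<alpha>))"

definition univoque :: "nat \<Rightarrow> (nat \<Rightarrow> nat) \<Rightarrow> (nat \<Rightarrow> nat) \<Rightarrow> bool" where
  "univoque m \<alpha> c \<longleftrightarrow> digits m c \<and>
     (\<forall>n. (c n < m \<longrightarrow> shift (Suc n) c <\<^sub>l \<alpha>) \<and>
          (0 < c n \<longrightarrow> reflection m (shift (Suc n) c) <\<^sub>l \<alpha>))"

lemma univoque_reflection: "univoque m \<alpha> c \<Longrightarrow> univoque m \<alpha> (reflection m c)"
  unfolding univoque_def
  by (auto simp: reflection_shift[symmetric])

text \<open>Conditions at digits of \<open>d\<close> are inherited from \<open>d\<close>, so only
  the tails following one of the \<open>n\<close> new digits remain; the case \<open>j = n\<close>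
  concerns \<open>d\<close> itself.\<close>

lemma univoque_prepend:
  assumes "univoque m \<alpha> d" "\<And>i. i < n \<Longrightarrow> a i \<le> m"
    and "\<And>j. 1 \<le> j \<Longrightarrow> j \<le> n \<Longrightarrow> a (j - 1) < m \<Longrightarrow> prepend (n - j) (shift j a) d <\<^sub>l \<alpha>"
    and "\<And>j. 1 \<le> j \<Longrightarrow> j \<le> n \<Longrightarrow> 0 < a (j - 1) \<Longrightarrow>
           reflection m (prepend (n - j) (shift j a) d) <\<^sub>l \<alpha>"
  shows "univoque m \<alpha> (prepend n a d)"
  unfolding univoque_def
proof (intro conjI allI)
  show "digits m (prepend n a d)"
    using assms by (intro digits_prepend) (auto simp: univoque_def)
  fix i
  show "prepend n a d i < m \<longrightarrow> shift (Suc i) (prepend n a d) <\<^sub>l \<alpha>"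
    and "0 < prepend n a d i \<longrightarrow> reflection m (shift (Suc i) (prepend n a d)) <\<^sub>l \<alpha>"
  proof (atomize (full), cases "i < n")
    case True
    then have "prepend n a d i = a i"
      by (simp add: prepend_def)
    moreover have "shift (Suc i) (prepend n a d) = prepend (n - Suc i) (shift (Suc i) a) d"
      using True by (simp add: shift_prepend_le)
    ultimately show "(prepend n a d i < m \<longrightarrow> shift (Suc i) (prepend n a d) <\<^sub>l \<alpha>) \<and>
      (0 < prepend n a d i \<longrightarrow> reflection m (shift (Suc i) (prepend n a d)) <\<^sub>l \<alpha>)"
      using assms(3,4)[of "Suc i"] True by simp
  next
    case False
    then have "prepend n a d i = d (i - n)"
      by (simp add: prepend_def)
    moreover have "shift (Suc i) (prepend n a d) = shift (Suc (i - n)) d"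
      using False by (simp add: shift_prepend_ge Suc_diff_le)
    ultimately show "(prepend n a d i < m \<longrightarrow> shift (Suc i) (prepend n a d) <\<^sub>l \<alpha>) \<and>
      (0 < prepend n a d i \<longrightarrow> reflection m (shift (Suc i) (prepend n a d)) <\<^sub>l \<alpha>)"
      using assms(1) by (simp add: univoque_def)
  qed
qed

subsection \<open>Lowering the last digit of a block\<close>

text \<open>Lowering the last digit of such a block and repeating it periodically cannot create a
  forbidden tail.\<close>

definition good_block :: "nat \<Rightarrow> (nat \<Rightarrow> nat) \<Rightarrow> nat \<Rightarrow> bool" where
  "good_block m \<alpha> L \<longleftrightarrow> 1 \<le> L \<and> 0 < \<alpha> (L - 1) \<and>
     (\<forall>j. 1 \<le> j \<and> j < L \<and> 0 < \<alpha> (j - 1) \<longrightarrow> (\<exists>i<L - j. m - \<alpha> (j + i) \<noteq> \<alpha> i))"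

text \<open>The subtraction does not truncate on a good block, whose last digit is positive.\<close>

definition lowered :: "nat \<Rightarrow> (nat \<Rightarrow> nat) \<Rightarrow> nat \<Rightarrow> nat" where
  "lowered L \<alpha> = (\<lambda>i. if i mod L = L - 1 then \<alpha> (L - 1) - 1 else \<alpha> (i mod L))"

lemma quasi_admissibleD:
  assumes "quasi_admissible m \<alpha>"
  shows "digits m \<alpha>"
    and "1 \<le> j \<Longrightarrow> \<alpha> (j - 1) < m \<Longrightarrow> shift j \<alpha> \<le>\<^sub>l \<alpha>"
    and "1 \<le> j \<Longrightarrow> 0 < \<alpha> (j - 1) \<Longrightarrow> reflection m (shift j \<alpha>) \<le>\<^sub>l \<alpha>"
proof -
  show "digits m \<alpha>" using assms by (simp add: quasi_admissible_def)
  show "1 \<le> j \<Longrightarrow> \<alpha> (j - 1) < m \<Longrightarrow> shift j \<alpha> \<le>\<^sub>l \<alpha>"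
    "1 \<le> j \<Longrightarrow> 0 < \<alpha> (j - 1) \<Longrightarrow> reflection m (shift j \<alpha>) \<le>\<^sub>l \<alpha>"
    using assms unfolding quasi_admissible_def by (metis One_nat_def Suc_pred' less_eq_Suc_le)+
qed

lemma quasi_admissible_le: "quasi_admissible m \<alpha> \<Longrightarrow> \<alpha> i \<le> m"
  using quasi_admissibleD(1) by (simp add: digits_def)

text \<open>A good block turns the weak inequality of \<open>quasi_admissible\<close> into a strict
  one that is decided inside the block, hence independent of the digits from position
  \<open>L\<close> on.\<close>

lemma good_block_lex_at:
  assumes "quasi_admissible m \<alpha>" "good_block m \<alpha> L" "1 \<le> j" "j < L" "0 < \<alpha> (j - 1)"
  obtains k where "k < L - j" "lex_at k (reflection m (shift j \<alpha>)) \<alpha>"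
proof -
  have "reflection m (shift j \<alpha>) \<le>\<^sub>l \<alpha>"
    using assms quasi_admissibleD by blast
  then show thesis
  proof (cases rule: lex_prefix[where N = "L - j"])
    case 2
    then show thesis using assms unfolding good_block_def by auto
  qed (rule that)
qed

context
  fixes m L :: nat and \<alpha> :: "nat \<Rightarrow> nat"
  assumes qa: "quasi_admissible m \<alpha>" and good: "good_block m \<alpha> L"
begin

lemma good_block_length_pos: "1 \<le> L" and good_block_last_pos: "0 < \<alpha> (L - 1)"
  using good by (auto simp: good_block_def)

lemma lowered_below: "i < L - 1 \<Longrightarrow> lowered L \<alpha> i = \<alpha> i"
  by (simp add: lowered_def)

lemma lowered_last: "lowered L \<alpha> (L - 1) = \<alpha> (L - 1) - 1"
  using good_block_length_pos by (simp add: lowered_def)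

lemma lowered_le: "lowered L \<alpha> i \<le> m"
  using quasi_admissible_le[OF qa, of "L - 1"] quasi_admissible_le[OF qa, of "i mod L"] by (auto simp: lowered_def)

lemma shift_lowered: "shift (k * L + j) (lowered L \<alpha>) = shift j (lowered L \<alpha>)"
  by (simp add: lowered_def shift_def fun_eq_iff add.assoc)

lemma lowered_less: "lowered L \<alpha> <\<^sub>l \<alpha>"
proof (rule lex_lessI[of "L - 1"])
  show "lowered L \<alpha> (L - 1) < \<alpha> (L - 1)" using good_block_last_pos by (simp only: lowered_last)
qed (simp add: lowered_below)

text \<open>Swapping the sides in \<open>good_block_lex_at\<close> puts the reflection of \<alpha>
  strictly below its tail. The deciding position \<open>k < L - i\<close> lies before
  \<open>L - 1\<close>, where \<alpha> and the lowered sequence still agree. This settles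
  comparisons that tie up to the end of a block.\<close>

lemma lowered_greater_tail:
  assumes "1 \<le> i" "i < L" "0 < \<alpha> (i - 1)"
  shows "reflection m (lowered L \<alpha>) <\<^sub>l shift i \<alpha>"
proof -
  obtain k where k: "k < L - i" "lex_at k (reflection m (shift i \<alpha>)) \<alpha>"
    using good_block_lex_at[OF qa good assms] .
  have dig: "digits m \<alpha>" using qa by (rule quasi_admissibleD(1))
  then have swap: "lex_at k (reflection m \<alpha>) (shift i \<alpha>)"
    by (rule lex_reflection_swap[OF digits_shift _ k(2)]) (rule dig)
  have eq: "lowered L \<alpha> j = \<alpha> j" if "j \<le> k" for j
    using that k(1) assms(1) by (intro lowered_below) linarith
  show ?thesis
  proof (rule lex_lessI[of k])
    show "reflection m (lowered L \<alpha>) j = shift i \<alpha> j" if "j < k" for j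
      using swap that eq[of j] by (simp add: lex_at_def)
    show "reflection m (lowered L \<alpha>) k < shift i \<alpha> k"
      using swap eq[of k] by (simp add: lex_at_def)
  qed
qed

text \<open>The assumption puts the first digit of the reflection below \<open>\<alpha> 0\<close>,
  and by periodicity only tails starting within one block matter. Lowering the last digit favours
  the upper bound; it can spoil the lower one only where that inequality was decided at this very
  digit.\<close>

lemma univoque_lowered:
  assumes "m < lowered L \<alpha> 0 + \<alpha> 0"
  shows "univoque m \<alpha> (lowered L \<alpha>)" and "reflection m (lowered L \<alpha>) <\<^sub>l \<alpha>"
proof -
  define w where "w = lowered L \<alpha>"
  show refl: "reflection m (lowered L \<alpha>) <\<^sub>l \<alpha>"
    using assms lowered_le[of 0] by (intro lex_lessI[of 0]) auto
  have wL: "shift L w = w"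
    using shift_lowered[of 1 0] by (simp add: w_def)
  have inner: "(w (j - 1) < m \<longrightarrow> shift j w <\<^sub>l \<alpha>) \<and>
      (0 < w (j - 1) \<longrightarrow> reflection m (shift j w) <\<^sub>l \<alpha>)" if j: "1 \<le> j" "j < L" for j
  proof (intro conjI impI)
    have wj: "w (j - 1) = \<alpha> (j - 1)"
      unfolding w_def using j by (intro lowered_below) auto
    have wi: "w (j + i) = \<alpha> (j + i)" if "i < L - j - 1" for i
      unfolding w_def using that j by (intro lowered_below) auto
    have idx: "j + (L - j - 1) = L - 1" using j by simp
    have wl: "w (L - 1) = \<alpha> (L - 1) - 1"
      unfolding w_def by (rule lowered_last)
    {
      assume "w (j - 1) < m"
      then have le: "shift j \<alpha> \<le>\<^sub>l \<alpha>"
        using quasi_admissibleD(2)[OF qa] wj j by simp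
      then show "shift j w <\<^sub>l \<alpha>"
      proof (cases rule: lex_prefix[where N = "L - j - 1"])
        case (1 k)
        then show ?thesis
          by (intro lex_lessI[of k]) (auto simp: lex_at_def wi)
      next
        case 2
        \<comment> \<open>The comparison ties up to the last digit of the block. That digit obeys
          the weak inequality in \<alpha>, and lowering it makes the inequality strict.\<close>
        have "\<alpha> (j + (L - j - 1)) \<le> \<alpha> (L - j - 1)"
          using lex_first[OF le 2] by simp
        then have "w (j + (L - j - 1)) < \<alpha> (L - j - 1)"
          using good_block_last_pos wl unfolding idx by linarith
        then show ?thesis
          using 2 by (intro lex_lessI[of "L - j - 1"]) (auto simp: wi)
      qed
    next
      assume "0 < w (j - 1)"
      then have pos: "0 < \<alpha> (j - 1)" by (simp only: wj)
      obtain k where k: "k < L - j" "lex_at k (reflection m (shift j \<alpha>)) \<alpha>"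
        using good_block_lex_at[OF qa good j pos] .
      show "reflection m (shift j w) <\<^sub>l \<alpha>"
      proof (cases "k = L - j - 1")
        case False
        with k have "k < L - j - 1" by simp
        with k(2) show ?thesis
          by (intro lex_lessI[of k]) (auto simp: lex_at_def wi)
      next
        case True
        have eq: "m - w (j + i) = \<alpha> i" if "i < L - j - 1" for i
          using k(2) that True by (auto simp: lex_at_def wi)
        have lt: "m - \<alpha> (L - 1) < \<alpha> (L - j - 1)"
          using k(2) True idx by (auto simp: lex_at_def)
        have last: "m - w (L - 1) = Suc (m - \<alpha> (L - 1))"
          using wl good_block_last_pos quasi_admissible_le[OF qa, of "L - 1"] by linarith
        show ?thesis
        proof (cases "m - w (L - 1) = \<alpha> (L - j - 1)")
          case False
          then have "m - w (j + (L - j - 1)) < \<alpha> (L - j - 1)"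
            using lt last unfolding idx by linarith
          then show ?thesis
            by (intro lex_lessI[of "L - j - 1"]) (auto simp: eq)
        next
          case True
          \<comment> \<open>Raising the reflected digit by 1 has produced a tie over the rest of the
            block, so the next period of \<open>w\<close> decides.\<close>
          have "reflection m w <\<^sub>l shift (L - j) \<alpha>"
            unfolding w_def using j lt by (intro lowered_greater_tail) auto
          then have drop: "shift (L - j) (reflection m (shift j w)) <\<^sub>l shift (L - j) \<alpha>"
            using j wL by (simp add: reflection_shift[symmetric])
          have "reflection m (shift j w) i = \<alpha> i" if "i < L - j" for i
          proof (cases "i = L - j - 1")
            case False
            then show ?thesis using eq[of i] that by simp
          next
            case iL: True
            show ?thesis unfolding iL reflection_apply shift_apply idx by (rule True)
          qed
          then show ?thesis using drop by (rule lex_append)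
        qed
      qed
    }
  qed
  have block: "(w (j - 1) < m \<longrightarrow> shift j w <\<^sub>l \<alpha>) \<and>
      (0 < w (j - 1) \<longrightarrow> reflection m (shift j w) <\<^sub>l \<alpha>)" if "1 \<le> j" "j \<le> L" for j
    using that inner[of j] wL refl lowered_less by (cases "j = L") (auto simp: w_def)
  have "(w n < m \<longrightarrow> shift (Suc n) w <\<^sub>l \<alpha>) \<and>
      (0 < w n \<longrightarrow> reflection m (shift (Suc n) w) <\<^sub>l \<alpha>)" for n
  proof -
    have "n = n div L * L + n mod L" by simp
    then have "w n = w (n mod L)" "shift (Suc n) w = shift (Suc (n mod L)) w"
      using shift_lowered[of "n div L" "Suc (n mod L)"] 
      by (simp_all add: w_def lowered_def)
    then show ?thesis using block[of "Suc (n mod L)"] good_block_length_pos by (simp add: Suc_le_eq)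
  qed
  then show "univoque m \<alpha> (lowered L \<alpha>)"
    unfolding univoque_def w_def by (simp add: digits_def lowered_le)
qed

end

subsection \<open>Univoque pairs from periodic quasi-admissible sequences\<close>

lemma prepend_0 [simp]: "prepend 0 a d = d"
  by (simp add: prepend_def)

lemma lex_drop_le:
  assumes "x \<le>\<^sub>l y" "\<And>i. i < N \<Longrightarrow> x i = y i"
  shows "shift N x \<le>\<^sub>l shift N y"
  using assms lex_drop unfolding lex_le_def by blast

lemma lex_sandwich:
  assumes "x \<le>\<^sub>l y" "y \<le>\<^sub>l z" "\<And>i. i < N \<Longrightarrow> x i = z i" "i < N"
  shows "y i = z i"
  using assms(2)
proof (cases rule: lex_prefix[where N = N])
  case (1 k)
  then have "y <\<^sub>l x"
    using assms(3) by (intro lex_lessI[of k]) (auto simp: lex_at_def)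
  with lex_antisym assms(1) show ?thesis by blast
qed (use assms(4) in auto)

lemma univoque_prepend_zeros:
  assumes "univoque m \<alpha> d" "d <\<^sub>l \<alpha>" "0 < \<alpha> 0"
  shows "univoque m \<alpha> (prepend N (\<lambda>_. 0) d)"
proof (rule univoque_prepend[OF assms(1)])
  fix j
  show "prepend (N - j) (shift j (\<lambda>_. 0)) d <\<^sub>l \<alpha>"
  proof (cases "N - j = 0")
    case False
    then show ?thesis
      using assms(3) by (intro lex_lessI[of 0]) (auto simp: prepend_def)
  qed (use assms(2) in simp)
qed auto

text \<open>\<open>first\<close> holds when \<open>n\<close> is the first index at which a weak
  inequality of \<open>quasi_admissible\<close> is an equality: all earlier ones are strict.\<close>

context
  fixes m n :: nat and \<alpha> :: "nat \<Rightarrow> nat"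
  assumes qa: "quasi_admissible m \<alpha>"
    and n: "1 \<le> n"
    and first: "\<And>j. 1 \<le> j \<Longrightarrow> j < n \<Longrightarrow> \<alpha> (j - 1) < m \<Longrightarrow> shift j \<alpha> \<noteq> \<alpha>"
      "\<And>j. 1 \<le> j \<Longrightarrow> j < n \<Longrightarrow> 0 < \<alpha> (j - 1) \<Longrightarrow> reflection m (shift j \<alpha>) \<noteq> \<alpha>"
begin

text \<open>Call \<open>j\<close> a bad start of a block if the reflection of the rest of the block
  from \<open>j\<close> on is a prefix of \<alpha>. If a long prefix of \<alpha> is not good, its
  least bad start is the length of a good block: a bad start inside that shorter block would extend
  to one of the long prefix.\<close>

lemma good_block_periodic:
  assumes period: "shift n \<alpha> = \<alpha>" and large: "m < 2 * \<alpha> 0"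
  obtains L where "n < L" "good_block m \<alpha> L"
proof -
  have "\<exists>p. m - \<alpha> (j + p) \<noteq> \<alpha> p" if j: "1 \<le> j" "j \<le> n" "0 < \<alpha> (j - 1)" for j
  proof (cases "j = n")
    case True
    have "\<alpha> n = \<alpha> 0" using fun_cong[OF period, of 0] by simp
    then show ?thesis using True large quasi_admissible_le[OF qa, of 0] by (intro exI[of _ 0]) auto
  next
    case False
    then show ?thesis using first(2)[of j] j by (auto simp: fun_eq_iff)
  qed
  then obtain f where f: "\<And>j. 1 \<le> j \<Longrightarrow> j \<le> n \<Longrightarrow> 0 < \<alpha> (j - 1) \<Longrightarrow> m - \<alpha> (j + f j) \<noteq> \<alpha> (f j)"
    by metis
  define P where "P = (\<Sum>j\<le>n. f j)"
  have fP: "f j \<le> P" if "j \<le> n" for j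
    unfolding P_def using that by (intro member_le_sum) auto
  \<comment> \<open>\<open>N\<close> is congruent to 1 modulo \<open>n\<close>, so the block ends
    with \<open>\<alpha> 0\<close>. It exceeds \<open>n + P\<close>, so every start
    \<open>j \<le> n\<close> meets its mismatch, at most \<open>P\<close> digits later, before the
    block ends.\<close>
  define N where "N = n * (n + P + 1) + 1"
  have N: "n + P + 2 \<le> N"
  proof -
    define K where "K = n + P + 1"
    have "K \<le> n * K" using n by simp
    then show ?thesis unfolding N_def K_def by linarith
  qed
  have "shift (n * k) \<alpha> = \<alpha>" for k
    by (induction k) (simp, metis mult_Suc_right period shift_shift)
  then have "\<alpha> (N - 1) = \<alpha> 0" unfolding N_def by (metis add_0_right add_diff_cancel_right' shift_apply)
  then have Npos: "0 < \<alpha> (N - 1)" using large by simp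
  show thesis
  proof (cases "good_block m \<alpha> N")
    case True
    then show thesis using that[of N] N by simp
  next
    case False
    define B where "B j \<longleftrightarrow> 1 \<le> j \<and> j < N \<and> 0 < \<alpha> (j - 1) \<and> (\<forall>i<N - j. m - \<alpha> (j + i) = \<alpha> i)" for j
    define L where "L = (LEAST j. B j)"
    have "\<exists>j. B j" using False N Npos unfolding good_block_def B_def by auto
    then have BL: "B L" unfolding L_def by (rule LeastI_ex)
    have least: "L \<le> j" if "B j" for j unfolding L_def using that by (rule Least_le)
    have "n < L"
    proof (rule ccontr)
      assume "\<not> n < L"
      then have "f L < N - L" "m - \<alpha> (L + f L) \<noteq> \<alpha> (f L)"
        using BL N fP[of L] f[of L] by (auto simp: B_def)
      with BL show False by (auto simp: B_def)
    qed
    moreover have "good_block m \<alpha> L"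
    proof -
      have False if i: "1 \<le> i" "i < L" "0 < \<alpha> (i - 1)" and match: "\<And>t. t < L - i \<Longrightarrow> m - \<alpha> (i + t) = \<alpha> t" for i
      proof -
        define s where "s = L - i"
        have s: "1 \<le> s" "i + s = L" using i by (auto simp: s_def)
        \<comment> \<open>The digit before the tail at \<open>s\<close> is the reflection of the
          positive last digit of the block, hence below \<open>m\<close>; this makes the upper bound
          on that tail available.\<close>
        have "\<alpha> (s - 1) = m - \<alpha> (L - 1)" using match[of "s - 1"] s by (simp add: s_def)
        then have "\<alpha> (s - 1) < m" using BL quasi_admissible_le[OF qa, of "L - 1"] by (auto simp: B_def)
        then have up: "shift s \<alpha> \<le>\<^sub>l \<alpha>" using quasi_admissibleD(2)[OF qa s(1)] by simp
        have "reflection m (shift i \<alpha>) \<le>\<^sub>l \<alpha>" using quasi_admissibleD(3)[OF qa] i by simp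
        then have "shift s (reflection m (shift i \<alpha>)) \<le>\<^sub>l shift s \<alpha>"
          by (rule lex_drop_le) (simp add: match s_def)
        then have lo: "reflection m (shift L \<alpha>) \<le>\<^sub>l shift s \<alpha>"
          using s by (simp add: reflection_shift[symmetric])
        \<comment> \<open>The lower bound agrees with \<alpha> on \<open>N - L\<close> digits
          because \<open>L\<close> is a bad start for \<open>N\<close>; the tail squeezed between
          them agrees as well.\<close>
        have eq: "shift s \<alpha> t = \<alpha> t" if "t < N - L" for t
          using lo up
        proof (rule lex_sandwich)
          show "t < N - L" by (rule that)
        qed (use BL in \<open>auto simp: B_def\<close>)
        have "m - \<alpha> (i + t) = \<alpha> t" if "t < N - i" for t
        proof (cases "t < s")
          case True
          then show ?thesis using match by (simp add: s_def)
        next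
          case False
          define u where "u = t - s"
          have u: "t = s + u" "i + t = L + u" "u < N - L"
            using False that s by (auto simp: u_def)
          have "m - \<alpha> (L + u) = \<alpha> u" using BL u by (simp add: B_def)
          with eq[OF u(3)] show ?thesis unfolding u(2) unfolding u(1) by simp
        qed
        then have "B i" using i BL by (auto simp: B_def)
        then show False using least i by fastforce
      qed
      then show ?thesis using BL unfolding good_block_def B_def by metis
    qed
    ultimately show thesis by (rule that)
  qed
qed

text \<open>A good block longer than \<open>n\<close> makes \<open>d\<close> smaller than every tail
  of \<alpha> that follows a positive digit among its first \<open>n - 1\<close> digits. This
  absorbs the ties caused by raising the digit at \<open>n - 1\<close>.\<close>

lemma univoque_pair_periodic:
  assumes period: "shift n \<alpha> = \<alpha>" and last: "\<alpha> (n - 1) < m" and large: "m < 2 * \<alpha> 0"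
  obtains d where
    "univoque m \<alpha> (prepend n (\<alpha>(n - 1 := Suc (\<alpha> (n - 1)))) d)"
    "univoque m \<alpha> (prepend n (\<lambda>_. 0) d)"
proof -
  obtain L where L: "n < L" and good: "good_block m \<alpha> L"
    using good_block_periodic[OF period large] .
  define w where "w = lowered L \<alpha>"
  define d where "d = reflection m w"
  define \<beta> where "\<beta> = \<alpha>(n - 1 := Suc (\<alpha> (n - 1)))"
  \<comment> \<open>\<open>n < L\<close> gives \<open>2 \<le> L\<close>, so the first digit is not
    the lowered one.\<close>
  have "w 0 = \<alpha> 0" unfolding w_def using L n by (intro lowered_below[OF qa good]) auto
  then have sum: "m < lowered L \<alpha> 0 + \<alpha> 0" using large by (simp add: w_def)
  have w: "univoque m \<alpha> w" "d <\<^sub>l \<alpha>" "w <\<^sub>l \<alpha>"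
    using univoque_lowered[OF qa good sum] lowered_less[OF qa good] by (simp_all add: w_def d_def)
  have d: "univoque m \<alpha> d" "reflection m d = w"
    using univoque_reflection[OF w(1)] w(1) by (simp_all add: d_def univoque_def)
  have tail: "d <\<^sub>l shift i \<alpha>" if "1 \<le> i" "i < n" "0 < \<alpha> (i - 1)" for i
    unfolding d_def w_def using that L by (intro lowered_greater_tail[OF qa good]) auto
  have \<beta>_le: "\<beta> i \<le> m" for i
    using quasi_admissible_le[OF qa, of i] last by (simp add: \<beta>_def)
  have \<beta>_below: "\<beta> i = \<alpha> i" if "i < n - 1" for i
    using that by (simp add: \<beta>_def)
  have \<beta>_last: "\<beta> (n - 1) = Suc (\<alpha> (n - 1))"
    by (simp add: \<beta>_def)
  have "univoque m \<alpha> (prepend n \<beta> d)"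
  proof (rule univoque_prepend[OF d(1)])
    fix j
    assume j: "1 \<le> j" "j \<le> n"
    define x where "x = prepend (n - j) (shift j \<beta>) d"
    have xi: "x i = \<alpha> (j + i)" if "i < n - j - 1" for i
    proof -
      have "i < n - j" "j + i < n - 1" using that by linarith+
      then show ?thesis by (simp add: x_def prepend_def \<beta>_below)
    qed
    have xl: "x (n - j - 1) = Suc (\<alpha> (n - 1))" if "j < n"
    proof -
      have "n - j - 1 < n - j" "j + (n - j - 1) = n - 1" using that by linarith+
      then show ?thesis by (simp only: x_def prepend_def shift_apply \<beta>_last if_True)
    qed
    have xn: "shift (n - j) x = d"
      by (simp add: x_def shift_prepend_ge)
    have idx: "j + (n - j - 1) = n - 1" if "j < n" using that by simp
    {
      assume prev: "\<beta> (j - 1) < m"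
      show "x <\<^sub>l \<alpha>"
      proof (cases "j = n")
        case True
        then show ?thesis using w(2) by (simp add: x_def)
      next
        case False
        then have jn: "j < n" using j by simp
        then have prev': "\<alpha> (j - 1) < m" using prev \<beta>_below[of "j - 1"] j by simp
        have le: "shift j \<alpha> \<le>\<^sub>l \<alpha>" using quasi_admissibleD(2)[OF qa j(1) prev'] .
        moreover have ne: "shift j \<alpha> \<noteq> \<alpha>" using first(1) j(1) jn prev' by blast
        ultimately have less: "shift j \<alpha> <\<^sub>l \<alpha>" by (simp add: lex_le_def)
        from le show ?thesis
        proof (cases rule: lex_prefix[where N = "n - j - 1"])
          case (1 k)
          then show ?thesis by (intro lex_lessI[of k]) (auto simp: lex_at_def xi)
        next
          case 2
          have "shift j \<alpha> (n - j - 1) \<le> \<alpha> (n - j - 1)"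
            using le 2 by (rule lex_first)
          then have "\<alpha> (n - 1) \<le> \<alpha> (n - j - 1)"
            unfolding shift_apply idx[OF jn] .
          \<comment> \<open>Equality would extend the agreement to the end of the period and leave
            \<alpha> strictly below its own tail at \<open>n - j\<close>. That tail follows a digit
            below \<open>m\<close>, so admissibility forbids this.\<close>
          moreover have "\<alpha> (n - 1) \<noteq> \<alpha> (n - j - 1)"
          proof
            assume eq: "\<alpha> (n - 1) = \<alpha> (n - j - 1)"
            have "shift j \<alpha> i = \<alpha> i" if "i < n - j" for i
            proof (cases "i = n - j - 1")
              case False
              then show ?thesis using 2[of i] that by simp
            next
              case True
              show ?thesis unfolding True shift_apply idx[OF jn] by (rule eq)
            qed
            with less have "shift (n - j) (shift j \<alpha>) <\<^sub>l shift (n - j) \<alpha>"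
              by (rule lex_drop)
            then have "\<alpha> <\<^sub>l shift (n - j) \<alpha>" using jn period by simp
            moreover have "shift (n - j) \<alpha> \<le>\<^sub>l \<alpha>"
              using jn eq last by (intro quasi_admissibleD(2)[OF qa]) auto
            ultimately show False using lex_antisym by blast
          qed
          ultimately have lt: "\<alpha> (n - 1) < \<alpha> (n - j - 1)" by simp
          show ?thesis
          proof (cases "Suc (\<alpha> (n - 1)) = \<alpha> (n - j - 1)")
            case False
            then have "x (n - j - 1) < \<alpha> (n - j - 1)" using lt xl[OF jn] by simp
            then show ?thesis using 2 by (intro lex_lessI[of "n - j - 1"]) (auto simp: xi)
          next
            case True
            have "x i = \<alpha> i" if "i < n - j" for i
            proof (cases "i = n - j - 1")
              case False
              then show ?thesis using 2[of i] xi[of i] that by simp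
            next
              case i: True
              show ?thesis unfolding i using xl[OF jn] True by simp
            qed
            \<comment> \<open>The raised digit ties; what follows is \<open>d\<close>, which lies
              below this tail of \<alpha>.\<close>
            moreover have "shift (n - j) x <\<^sub>l shift (n - j) \<alpha>"
              unfolding xn using jn j(1) True by (intro tail) (auto simp flip: True)
            ultimately show ?thesis by (rule lex_append)
          qed
        qed
      qed
    next
      assume prev: "0 < \<beta> (j - 1)"
      show "reflection m x <\<^sub>l \<alpha>"
      proof (cases "j = n")
        case True
        then show ?thesis using w(3) d(2) by (simp add: x_def)
      next
        case False
        then have jn: "j < n" using j by simp
        then have prev': "0 < \<alpha> (j - 1)" using prev \<beta>_below[of "j - 1"] j by simp
        have le: "reflection m (shift j \<alpha>) \<le>\<^sub>l \<alpha>" using quasi_admissibleD(3)[OF qa j(1) prev'] .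
        then show ?thesis
        proof (cases rule: lex_prefix[where N = "n - j - 1"])
          case (1 k)
          then show ?thesis by (intro lex_lessI[of k]) (auto simp: lex_at_def xi)
        next
          case 2
          have "reflection m (shift j \<alpha>) (n - j - 1) \<le> \<alpha> (n - j - 1)"
            using le 2 by (rule lex_first)
          then have "m - \<alpha> (n - 1) \<le> \<alpha> (n - j - 1)"
            unfolding reflection_apply shift_apply idx[OF jn] .
          \<comment> \<open>For the reflection the raised digit helps: the weak inequality becomes
            strict.\<close>
          then have "m - x (n - j - 1) < \<alpha> (n - j - 1)"
            using xl[OF jn] last by linarith
          then show ?thesis using 2 by (intro lex_lessI[of "n - j - 1"]) (auto simp: xi)
        qed
      qed
    }
  qed (rule \<beta>_le)
  moreover have "univoque m \<alpha> (prepend n (\<lambda>_. 0) d)"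
    using d(1) w(2) large by (intro univoque_prepend_zeros) auto
  ultimately show thesis using that unfolding \<beta>_def by blast
qed

text \<open>Here \<alpha> alternates between its first \<open>n\<close> digits and their reflection,
  and the block of length \<open>n\<close> is itself good. The first block of \<open>d\<close> is
  the reflected block with its last digit raised, so \<open>d\<close> appended to \<open>n\<close>
  digits of \<alpha> is already the first sequence of the pair. For \<open>n = 1\<close> the lowered
  digit is the first one, hence the stronger bound \<open>critical\<close>.\<close>

lemma univoque_pair_antiperiodic:
  assumes anti: "reflection m (shift n \<alpha>) = \<alpha>" and last: "0 < \<alpha> (n - 1)"
    and large: "m < 2 * \<alpha> 0" and critical: "n = 1 \<Longrightarrow> m + 1 < 2 * \<alpha> 0"
  obtains d where
    "univoque m \<alpha> (prepend (2 * n) (\<alpha>(2 * n - 1 := Suc (\<alpha> (2 * n - 1)))) d)"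
    "univoque m \<alpha> (prepend (2 * n) (\<lambda>_. 0) d)"
proof -
  have refl: "shift n \<alpha> = reflection m \<alpha>"
    using anti reflection_reflection[OF digits_shift[OF quasi_admissibleD(1)[OF qa]]] by metis
  have good: "good_block m \<alpha> n"
  proof -
    \<comment> \<open>A match to the end of the block leaves, by antiperiodicity, \<alpha> strictly
      below its tail at \<open>n - j\<close>. The digit before that tail is below \<open>m\<close>,
      so admissibility forbids this.\<close>
    have False if j: "1 \<le> j" "j < n" "0 < \<alpha> (j - 1)" and match: "\<And>i. i < n - j \<Longrightarrow> m - \<alpha> (j + i) = \<alpha> i" for j
    proof -
      have "reflection m (shift j \<alpha>) <\<^sub>l \<alpha>"
        using quasi_admissibleD(3)[OF qa] first(2) j unfolding lex_le_def by blast
      then have "shift (n - j) (reflection m (shift j \<alpha>)) <\<^sub>l shift (n - j) \<alpha>"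
        by (rule lex_drop) (simp add: match)
      moreover have "shift (n - j) (reflection m (shift j \<alpha>)) = \<alpha>"
        using anti j by (simp add: reflection_shift[symmetric])
      ultimately have "\<alpha> <\<^sub>l shift (n - j) \<alpha>" by simp
      moreover have "\<alpha> (n - j - 1) = m - \<alpha> (n - 1)" using match[of "n - j - 1"] j by simp
      then have "\<alpha> (n - j - 1) < m" using last quasi_admissible_le[OF qa, of "n - 1"] by linarith
      then have "shift (n - j) \<alpha> \<le>\<^sub>l \<alpha>"
        using j by (intro quasi_admissibleD(2)[OF qa]) auto
      ultimately show False using lex_antisym by blast
    qed
    then show ?thesis using n last unfolding good_block_def by metis
  qed
  define w where "w = lowered n \<alpha>"
  define d where "d = reflection m w"
  have sum: "m < lowered n \<alpha> 0 + \<alpha> 0"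
  proof (cases "n = 1")
    case True
    then show ?thesis using critical by (simp add: lowered_def)
  next
    case False
    then have "lowered n \<alpha> 0 = \<alpha> 0" using n by (intro lowered_below[OF qa good]) auto
    then show ?thesis using large by simp
  qed
  have w: "univoque m \<alpha> w" "d <\<^sub>l \<alpha>" "w <\<^sub>l \<alpha>"
    using univoque_lowered[OF qa good sum] lowered_less[OF qa good] by (simp_all add: w_def d_def)
  have d: "univoque m \<alpha> d" "reflection m d = w"
    using univoque_reflection[OF w(1)] w(1) by (simp_all add: d_def univoque_def)
  have tail: "d <\<^sub>l shift i \<alpha>" if "1 \<le> i" "i < n" "0 < \<alpha> (i - 1)" for i
    unfolding d_def w_def using that by (intro lowered_greater_tail[OF qa good]) auto
  have "univoque m \<alpha> (prepend n \<alpha> d)"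
  proof (rule univoque_prepend[OF d(1)])
    fix j
    assume j: "1 \<le> j" "j \<le> n"
    define x where "x = prepend (n - j) (shift j \<alpha>) d"
    have xi: "x i = \<alpha> (j + i)" if "i < n - j" for i
      using that by (simp add: x_def prepend_def)
    have xn: "shift (n - j) x = d"
      by (simp add: x_def shift_prepend_ge)
    {
      assume prev: "\<alpha> (j - 1) < m"
      show "x <\<^sub>l \<alpha>"
      proof (cases "j = n")
        case True
        then show ?thesis using w(2) by (simp add: x_def)
      next
        case False
        then have jn: "j < n" using j by simp
        have le: "shift j \<alpha> \<le>\<^sub>l \<alpha>" using quasi_admissibleD(2)[OF qa j(1) prev] .
        then show ?thesis
        proof (cases rule: lex_prefix[where N = "n - j"])
          case (1 k)
          then show ?thesis by (intro lex_lessI[of k]) (auto simp: lex_at_def xi)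
        next
          case 2
          have "n - j - 1 < n - j" "j + (n - j - 1) = n - 1" using jn by linarith+
          then have "\<alpha> (n - j - 1) = \<alpha> (n - 1)" using 2[of "n - j - 1"] by (simp only: shift_apply)
          then have "shift (n - j) x <\<^sub>l shift (n - j) \<alpha>"
            unfolding xn using jn j(1) last by (intro tail) auto
          moreover have "x i = \<alpha> i" if "i < n - j" for i
            using 2[OF that] by (simp only: xi[OF that] shift_apply)
          ultimately show ?thesis by (rule lex_append[rotated])
        qed
      qed
    next
      assume prev: "0 < \<alpha> (j - 1)"
      show "reflection m x <\<^sub>l \<alpha>"
      proof (cases "j = n")
        case True
        then show ?thesis using w(3) d(2) by (simp add: x_def)
      next
        case False
        then have jn: "j < n" using j by simp
        obtain k where "k < n - j" "lex_at k (reflection m (shift j \<alpha>)) \<alpha>"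
          using good_block_lex_at[OF qa good j(1) jn prev] .
        then show ?thesis by (intro lex_lessI[of k]) (auto simp: lex_at_def xi)
      qed
    }
  qed (rule quasi_admissible_le[OF qa])
  moreover have "prepend n \<alpha> d = prepend (2 * n) (\<alpha>(2 * n - 1 := Suc (\<alpha> (2 * n - 1)))) d"
  proof
    fix i
    have shift_w: "w (n + k) = w k" for k
      by (simp add: w_def lowered_def)
    have \<alpha>n: "\<alpha> (n + k) = m - \<alpha> k" for k
      using fun_cong[OF refl, of k] by simp
    consider "i < n" | "2 * n \<le> i" | "n \<le> i" "i < 2 * n - 1" | "i = 2 * n - 1" "1 \<le> n"
      using n by linarith
    then show "prepend n \<alpha> d i = prepend (2 * n) (\<alpha>(2 * n - 1 := Suc (\<alpha> (2 * n - 1)))) d i"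
    proof cases
      case 1
      then show ?thesis by (simp add: prepend_def)
    next
      case 2
      define k where "k = i - 2 * n"
      have "i = n + (n + k)" using 2 by (simp add: k_def)
      then show ?thesis by (simp add: prepend_def d_def shift_w)
    next
      case 3
      define k where "k = i - n"
      have k: "i = n + k" "k < n - 1" using 3 by (auto simp: k_def)
      have "w k = \<alpha> k" unfolding w_def using k(2) by (rule lowered_below[OF qa good])
      moreover have "n + k \<noteq> 2 * n - 1" "k < n" using k by linarith+
      ultimately show ?thesis using k by (simp add: prepend_def d_def \<alpha>n)
    next
      case 4
      have i: "i = n + (n - 1)" using 4 by simp
      have wl: "w (n - 1) = \<alpha> (n - 1) - 1" unfolding w_def by (rule lowered_last[OF qa good])
      have "m - (\<alpha> (n - 1) - 1) = Suc (m - \<alpha> (n - 1))"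
        using last quasi_admissible_le[OF qa, of "n - 1"] by linarith
      then have "m - w (n - 1) = Suc (\<alpha> i)" unfolding i \<alpha>n wl .
      moreover have "prepend n \<alpha> d i = m - w (n - 1)"
        unfolding i by (simp add: prepend_def d_def)
      moreover have "prepend (2 * n) (\<alpha>(2 * n - 1 := Suc (\<alpha> (2 * n - 1)))) d i = Suc (\<alpha> i)"
        unfolding 4(1) using n by (simp add: prepend_def)
      ultimately show ?thesis by simp
    qed
  qed
  moreover have "univoque m \<alpha> (prepend (2 * n) (\<lambda>_. 0) d)"
    using d(1) w(2) large by (intro univoque_prepend_zeros) auto
  ultimately show thesis using that by metis
qed

end

subsection \<open>Values of digit sequences\<close>

locale expansion_base =
  fixes m :: nat and q :: real
  assumes m_pos: "1 \<le> m" and q_gt_1: "1 < q" and q_le: "q \<le> real m + 1"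
begin

definition val :: "(nat \<Rightarrow> nat) \<Rightarrow> real" where
  "val c = (\<Sum>i. real (c i) / q ^ Suc i)"

definition top_val :: real  ("M") where
  "M = real m / (q - 1)"

lemma q_nonzero [simp]: "q \<noteq> 0" and q_pos: "0 < q"
  using q_gt_1 by auto

lemma M_ge_1: "1 \<le> M"
  using q_gt_1 q_le by (simp add: top_val_def field_simps)

lemma M_gt_1: "q < real m + 1 \<Longrightarrow> 1 < M"
  using q_gt_1 by (simp add: top_val_def field_simps)

lemma q_times_M: "q * M = real m + M"
  using q_gt_1 by (simp add: top_val_def field_simps)

lemma const_sums: "(\<lambda>i. real k / q ^ Suc i) sums (real k / (q - 1))"
proof -
  have "(\<lambda>i. real k / q * (1 / q) ^ i) sums (real k / q * (1 / (1 - 1 / q)))"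
    using q_gt_1 by (intro sums_mult geometric_sums) simp
  moreover have "real k / q * (1 / (1 - 1 / q)) = real k / (q - 1)"
    using q_gt_1 by (simp add: field_simps)
  moreover have "(\<lambda>i. real k / q * (1 / q) ^ i) = (\<lambda>i. real k / q ^ Suc i)"
    by (simp add: power_one_over)
  ultimately show ?thesis by metis
qed

lemma digits_summable: "digits m c \<Longrightarrow> summable (\<lambda>i. real (c i) / q ^ Suc i)"
  using q_gt_1
  by (intro summable_comparison_test'[OF sums_summable[OF const_sums[of m]], of 0])
     (auto simp: digits_def intro!: divide_right_mono)

lemma is_expansion_iff: "is_expansion m q x c \<longleftrightarrow> digits m c \<and> val c = x"
  unfolding is_expansion_def val_def digits_def
  using digits_summable by (auto simp: sums_iff digits_def)

lemma val_const: "val (\<lambda>_. k) = real k / (q - 1)"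
  using const_sums by (simp add: val_def sums_iff)

lemma val_zero [simp]: "val (\<lambda>_. 0) = 0"
  by (simp add: val_const)

lemma val_top [simp]: "val (\<lambda>_. m) = M"
  by (simp add: val_const top_val_def)

lemma val_nonneg: "digits m c \<Longrightarrow> 0 \<le> val c"
  unfolding val_def using q_gt_1 by (intro suminf_nonneg digits_summable) auto

lemma val_reflection: "digits m c \<Longrightarrow> val (reflection m c) = M - val c"
proof -
  assume c: "digits m c"
  have "M - val c = (\<Sum>i. real m / q ^ Suc i - real (c i) / q ^ Suc i)"
    using suminf_diff[OF sums_summable[OF const_sums[of m]] digits_summable[OF c]]
      const_sums[of m] by (simp add: val_def top_val_def sums_iff)
  also have "\<dots> = val (reflection m c)"
    using c by (simp add: val_def digits_def of_nat_diff diff_divide_distrib)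
  finally show ?thesis by simp
qed

lemma val_le_M: "digits m c \<Longrightarrow> val c \<le> M"
  using val_reflection[of c] val_nonneg[OF digits_reflection[of m c]] by simp

lemma val_split: "digits m c \<Longrightarrow> val c = (\<Sum>i<n. real (c i) / q ^ Suc i) + val (shift n c) / q ^ n"
proof -
  assume c: "digits m c"
  have "val c = (\<Sum>i. real (c (i + n)) / q ^ Suc (i + n)) + (\<Sum>i<n. real (c i) / q ^ Suc i)"
    unfolding val_def using suminf_split_initial_segment[OF digits_summable[OF c], of n] by simp
  also have "(\<Sum>i. real (c (i + n)) / q ^ Suc (i + n)) = (\<Sum>i. real (shift n c i) / q ^ Suc i / q ^ n)"
    by (simp add: power_add add.commute mult.assoc)
  also have "\<dots> = val (shift n c) / q ^ n"
    unfolding val_def by (intro suminf_divide digits_summable digits_shift c)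
  finally show ?thesis by simp
qed

lemma val_split_Suc: "digits m c \<Longrightarrow> val c = (\<Sum>i<n. real (c i) / q ^ Suc i)
    + (real (c n) + val (shift (Suc n) c)) / q ^ Suc n"
  using val_split[of c "Suc n"] by (simp add: add_divide_distrib)

lemma val_Suc: "digits m c \<Longrightarrow> q * val c = real (c 0) + val (shift 1 c)"
  using val_split_Suc[of c 0] q_gt_1 by (simp add: field_simps)

lemma val_pos: "digits m c \<Longrightarrow> 0 < c n \<Longrightarrow> 0 < val c"
proof -
  assume c: "digits m c" "0 < c n"
  have "0 < (real (c n) + val (shift (Suc n) c)) / q ^ Suc n"
    using c val_nonneg[of "shift (Suc n) c"] q_gt_1 by (intro divide_pos_pos) auto
  moreover have "0 \<le> (\<Sum>i<n. real (c i) / q ^ Suc i)"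
    using q_gt_1 by (intro sum_nonneg) auto
  ultimately show ?thesis using val_split_Suc[OF c(1), of n] by linarith
qed

text \<open>The basic modification: if \<open>e + val d\<close> equals the old digit plus the old
  tail value, the value is unchanged and another expansion of the same number arises.\<close>

lemma val_replace:
  assumes "digits m c" "digits m d" "e \<le> m"
  shows "val (prepend n c (case_nat e d)) = val c
    + (real e + val d - real (c n) - val (shift (Suc n) c)) / q ^ Suc n"
    and "digits m (prepend n c (case_nat e d))"
proof -
  let ?x = "prepend n c (case_nat e d)"
  show dig: "digits m ?x"
    using assms by (intro digits_prepend digits_case_nat) (auto simp: digits_def)
  have "shift (Suc n) ?x = d"
    by (simp add: shift_prepend_ge Suc_diff_le) (simp add: shift_def)
  moreover have "?x n = e" "(\<Sum>i<n. real (?x i) / q ^ Suc i) = (\<Sum>i<n. real (c i) / q ^ Suc i)"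
    by (simp_all add: prepend_def)
  ultimately show "val ?x = val c
    + (real e + val d - real (c n) - val (shift (Suc n) c)) / q ^ Suc n"
    using val_split_Suc[OF dig, of n] val_split_Suc[OF assms(1), of n]
    by (simp add: add_divide_distrib diff_divide_distrib)
qed

lemma first_difference:
  assumes "digits m c" "digits m d" "val c = val d" "c \<noteq> d"
  obtains n where "\<And>i. i < n \<Longrightarrow> c i = d i" "c n \<noteq> d n"
    "real (c n) + val (shift (Suc n) c) = real (d n) + val (shift (Suc n) d)"
proof -
  have "c <\<^sub>l d \<or> d <\<^sub>l c" using lex_total[of c d] assms(4) by (auto simp: lex_le_def)
  then obtain n where n: "\<And>i. i < n \<Longrightarrow> c i = d i" "c n \<noteq> d n"
    unfolding lex_less_def lex_at_def by (metis less_irrefl)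
  moreover have "(real (c n) + val (shift (Suc n) c)) / q ^ Suc n
      = (real (d n) + val (shift (Suc n) d)) / q ^ Suc n"
    using val_split_Suc[OF assms(1), of n] val_split_Suc[OF assms(2), of n] assms(3) n(1)
    by (simp del: power_Suc)
  then have "real (c n) + val (shift (Suc n) c) = real (d n) + val (shift (Suc n) d)"
    by simp
  ultimately show thesis by (rule that)
qed

text \<open>Digits chosen so that \<open>y \<mapsto> q * y - e\<close> never leaves the bounded set
  \<open>S\<close> form an expansion whose tail values are the orbit points. The closed interval as
  \<open>S\<close> gives existence of expansions, the open one gives doubly infinite
  expansions.\<close>

lemma expansion_with_orbit:
  assumes "x \<in> S" and S: "S \<subseteq> {0..M}"
    and step: "\<And>y. y \<in> S \<Longrightarrow> \<exists>e\<le>m. q * y - real e \<in> S"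
  obtains c where "digits m c" "val c = x" "\<And>n. val (shift n c) \<in> S"
proof -
  obtain dig where dig: "\<And>y. y \<in> S \<Longrightarrow> dig y \<le> m \<and> q * y - real (dig y) \<in> S"
    using step by metis
  define orb where "orb = rec_nat x (\<lambda>_ y. q * y - real (dig y))"
  have orb_0: "orb 0 = x" and orb_Suc: "\<And>n. orb (Suc n) = q * orb n - real (dig (orb n))"
    by (simp_all add: orb_def)
  have orb_S: "orb n \<in> S" for n
    by (induction n) (use assms(1) dig orb_0 orb_Suc in auto)
  have orb_bounds: "0 \<le> orb n" "orb n \<le> M" for n
    using orb_S[of n] S by auto
  define c where "c n = dig (orb n)" for n
  have c: "digits m c" using dig orb_S by (simp add: digits_def c_def)
  have val: "val (shift k c) = orb k" for k
  proof -
    \<comment> \<open>The partial sums telescope along the orbit, and its boundedness makes the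
      remainder vanish.\<close>
    have part: "(\<Sum>i<n. real (c (k + i)) / q ^ Suc i) = orb k - orb (k + n) / q ^ n" for n
    proof (induction n)
      case (Suc n)
      have "real (c (k + n)) = q * orb (k + n) - orb (k + Suc n)"
        using orb_Suc[of "k + n"] by (simp add: c_def)
      then have "real (c (k + n)) / q ^ Suc n = orb (k + n) / q ^ n - orb (k + Suc n) / q ^ Suc n"
        by (simp add: diff_divide_distrib)
      with Suc show ?case by (simp only: sum.lessThan_Suc)
    qed simp
    have "(\<lambda>n. orb (k + n) / q ^ n) \<longlonglongrightarrow> 0"
    proof (rule tendsto_sandwich[of "\<lambda>_. 0" _ _ "\<lambda>n. M / q ^ n"])
      show "(\<lambda>n. M / q ^ n) \<longlonglongrightarrow> 0"
        using q_gt_1 by (rule LIMSEQ_divide_realpow_zero)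
      show "\<forall>\<^sub>F n in sequentially. 0 \<le> orb (k + n) / q ^ n"
        using q_pos by (intro always_eventually allI divide_nonneg_pos) (auto simp: orb_bounds)
      show "\<forall>\<^sub>F n in sequentially. orb (k + n) / q ^ n \<le> M / q ^ n"
        using q_pos by (intro always_eventually allI divide_right_mono) (auto simp: orb_bounds)
    qed simp
    then have "(\<lambda>n. orb k - orb (k + n) / q ^ n) \<longlonglongrightarrow> orb k - 0"
      by (intro tendsto_diff tendsto_const)
    then have "(\<lambda>i. real (c (k + i)) / q ^ Suc i) sums orb k"
      unfolding sums_def part by simp
    then show ?thesis by (simp add: val_def sums_iff)
  qed
  show thesis
    by (rule that[of c]) (use c val[of 0] orb_0 val orb_S in auto)
qed

text \<open>The digit is the smaller of \<open>m\<close> and the floor of \<open>q * y\<close>: the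
  remainder is below 1, hence below or equal to \<open>M\<close>, or it is bounded by
  \<open>q * M - m = M\<close>.\<close>

lemma expansion_exists:
  assumes "0 \<le> x" "x \<le> M"
  obtains c where "digits m c" "val c = x"
proof (rule expansion_with_orbit[of x "{0..M}"])
  fix y assume y: "y \<in> {0..M}"
  show "\<exists>e\<le>m. q * y - real e \<in> {0..M}"
  proof (cases "q * y \<le> real m")
    case True
    define e where "e = nat \<lfloor>q * y\<rfloor>"
    have "0 \<le> q * y" using y q_gt_1 by simp
    then have "real e \<le> q * y" "q * y < real e + 1" unfolding e_def by linarith+
    moreover from this True have "e \<le> m" by linarith
    ultimately show ?thesis using M_ge_1 by (intro exI[of _ e]) auto
  next
    case False
    have "q * y \<le> q * M" using y q_gt_1 by (intro mult_left_mono) auto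
    then show ?thesis using False q_times_M by (intro exI[of _ m]) auto
  qed
qed (use assms in auto)

text \<open>For \<open>q * y \<le> m\<close>, rounding \<open>q * y\<close> up and subtracting 1
  leaves a remainder in \<open>(0, 1]\<close>, inside the open interval because
  \<open>1 < M\<close>. Tails with values strictly between 0 and \<open>M\<close> are neither all 0
  nor all \<open>m\<close>.\<close>

lemma doubly_infinite_exists:
  assumes "q < real m + 1" "0 < x" "x < M"
  obtains c where "digits m c" "val c = x" "doubly_infinite m c"
proof (rule expansion_with_orbit[of x "{0<..<M}"])
  fix y assume y: "y \<in> {0<..<M}"
  show "\<exists>e\<le>m. q * y - real e \<in> {0<..<M}"
  proof (cases "q * y \<le> real m")
    case True
    define e where "e = nat (\<lceil>q * y\<rceil> - 1)"
    have "0 < q * y" using y q_gt_1 by simp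
    then have "real e < q * y" "q * y \<le> real e + 1" unfolding e_def by linarith+
    moreover from this True have "e \<le> m" by linarith
    ultimately show ?thesis using M_gt_1[OF assms(1)] by (intro exI[of _ e]) auto
  next
    case False
    have "q * y < q * M" using y q_gt_1 by simp
    then show ?thesis using False q_times_M by (intro exI[of _ m]) auto
  qed
next
  fix c assume c: "digits m c" "val c = x" "\<And>n. val (shift n c) \<in> {0<..<M}"
  have "\<exists>i\<ge>n. c i \<noteq> 0" for n
  proof (rule ccontr)
    assume "\<not> ?thesis"
    then have "shift n c = (\<lambda>_. 0)" by (simp add: shift_def)
    then show False using c(3)[of n] by simp
  qed
  moreover have "\<exists>i\<ge>n. m - c i \<noteq> 0" for n
  proof (rule ccontr)
    assume none: "\<not> ?thesis"
    have "shift n c i = m" for i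
    proof -
      have "m - c (n + i) = 0" using none le_add1 by blast
      moreover have "c (n + i) \<le> m" using c(1) by (simp add: digits_def)
      ultimately show ?thesis by simp
    qed
    then have "shift n c = (\<lambda>_. m)" by (rule ext)
    then show False using c(3)[of n] by simp
  qed
  ultimately have "doubly_infinite m c"
    by (simp add: doubly_infinite_def infinite_seq_def infinite_nat_iff_unbounded_le)
  with c show thesis using that by blast
qed (use assms in auto)

lemma infinite_seq_shift: "infinite_seq c \<Longrightarrow> infinite_seq (shift n c)"
proof -
  assume c: "infinite_seq c"
  have "\<exists>i\<ge>k. c (n + i) \<noteq> 0" for k
  proof -
    obtain i where "n + k \<le> i" "c i \<noteq> 0"
      using c unfolding infinite_seq_def infinite_nat_iff_unbounded_le by blast
    then show ?thesis by (intro exI[of _ "i - n"]) auto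
  qed
  then show ?thesis by (simp add: infinite_seq_def infinite_nat_iff_unbounded_le)
qed

lemma doubly_infinite_shift: "doubly_infinite m c \<Longrightarrow> doubly_infinite m (shift n c)"
  unfolding doubly_infinite_def by (simp add: reflection_shift infinite_seq_shift)

lemma doubly_infinite_reflection:
  "digits m c \<Longrightarrow> doubly_infinite m c \<Longrightarrow> doubly_infinite m (reflection m c)"
  by (simp add: doubly_infinite_def)

lemma doubly_infinite_prepend: "doubly_infinite m d \<Longrightarrow> doubly_infinite m (prepend n c (case_nat e d))"
proof -
  have inf: "infinite_seq (prepend n c (case_nat e d))" if d: "infinite_seq d" for c d :: "nat \<Rightarrow> nat" and e
    unfolding infinite_seq_def infinite_nat_iff_unbounded_le
  proof
    fix k
    obtain i where "k \<le> i" "d i \<noteq> 0"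
      using d unfolding infinite_seq_def infinite_nat_iff_unbounded_le by blast
    then show "\<exists>i\<ge>k. i \<in> {i. prepend n c (case_nat e d) i \<noteq> 0}"
      by (intro exI[of _ "Suc (n + i)"]) (simp add: prepend_def Suc_diff_le)
  qed
  have "reflection m (prepend n c (case_nat e d)) =
      prepend n (reflection m c) (case_nat (m - e) (reflection m d))"
    by (auto simp: prepend_def reflection_def split: nat.split)
  then show "doubly_infinite m d \<Longrightarrow> doubly_infinite m (prepend n c (case_nat e d))"
    using inf by (simp add: doubly_infinite_def)
qed

lemma infinite_seq_val_pos:
  assumes "digits m c" "infinite_seq c"
  shows "0 < val c"
proof -
  obtain n where "c n \<noteq> 0"
    using assms(2) not_finite_existsD unfolding infinite_seq_def by blast
  then show ?thesis using val_pos[OF assms(1)] by blast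
qed

lemma doubly_infinite_val: "digits m c \<Longrightarrow> doubly_infinite m c \<Longrightarrow> 0 < val c \<and> val c < M"
  using infinite_seq_val_pos[of c] infinite_seq_val_pos[of "reflection m c"] val_reflection[of c]
  by (simp add: doubly_infinite_def)

end

subsection \<open>Characterizations of unique expansions\<close>

text \<open>The equation forces \<open>k + 1 < q\<close>, which selects the sign of the square root
  when completing the square.\<close>

lemma golden_odd:
  fixes q :: real
  assumes "m = 2 * k + 1" "0 < q"
  shows "q = golden m \<longleftrightarrow> q\<^sup>2 = (real k + 1) * (q + 1)"
proof -
  define s where "s = sqrt ((real k)\<^sup>2 + 6 * real k + 5)"
  have s: "0 \<le> s" "s\<^sup>2 = (real k)\<^sup>2 + 6 * real k + 5" by (simp_all add: s_def)
  have div: "m div 2 = k" using assms(1) by simp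
  have g: "golden m = (real k + 1 + s) / 2"
    unfolding golden_def div s_def using assms(1) by (simp add: Let_def)
  have sq: "(2 * q - (real k + 1))\<^sup>2 = s\<^sup>2 \<longleftrightarrow> q\<^sup>2 = (real k + 1) * (q + 1)"
    unfolding s(2) by (auto simp: power2_eq_square algebra_simps)
  show ?thesis
  proof
    assume "q = golden m"
    then have "2 * q - (real k + 1) = s" using g by simp
    then show "q\<^sup>2 = (real k + 1) * (q + 1)" using sq by simp
  next
    assume eq: "q\<^sup>2 = (real k + 1) * (q + 1)"
    then have "(real k + 1) * q < q * q" by (simp add: power2_eq_square algebra_simps)
    then have "real k + 1 < q" using assms(2) by simp
    then have "0 \<le> 2 * q - (real k + 1)" by simp
    with sq eq s(1) have "2 * q - (real k + 1) = s" by (simp add: power2_eq_iff_nonneg)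
    then show "q = golden m" using g by simp
  qed
qed

lemma golden_even: "m = 2 * k \<Longrightarrow> golden m = real k + 1"
  by (simp add: golden_def)

context expansion_base
begin

text \<open>Raising a digit by 1 must be compensated by a tail worth 1 less, lowering it by a tail
  worth 1 more. \<open>strict\<close> says that the new tail value always leaves
  \<open>[0, M]\<close>; \<open>weak\<close>, that it never lies in the open interval.\<close>

definition strict :: "(nat \<Rightarrow> nat) \<Rightarrow> bool" where
  "strict c \<longleftrightarrow> (\<forall>n. (c n < m \<longrightarrow> val (shift (Suc n) c) < 1) \<and>
     (0 < c n \<longrightarrow> M - 1 < val (shift (Suc n) c)))"

definition weak :: "(nat \<Rightarrow> nat) \<Rightarrow> bool" where
  "weak c \<longleftrightarrow> (\<forall>n. (c n < m \<longrightarrow> val (shift (Suc n) c) \<le> 1) \<and>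
     (0 < c n \<longrightarrow> M - 1 \<le> val (shift (Suc n) c)))"

lemma I_q_eq: "I_q m q = {0..M}"
  by (simp add: I_q_def top_val_def)

lemma mem_U_iff:
  "x \<in> U_q m q \<longleftrightarrow> (\<exists>c. digits m c \<and> val c = x \<and> (\<forall>d. digits m d \<longrightarrow> val d = x \<longrightarrow> d = c))"
proof -
  have "(\<exists>!c. digits m c \<and> val c = x) \<longleftrightarrow>
      (\<exists>c. digits m c \<and> val c = x \<and> (\<forall>d. digits m d \<longrightarrow> val d = x \<longrightarrow> d = c))"
    unfolding Ex1_def by blast
  then show ?thesis
    unfolding U_q_def I_q_eq is_expansion_iff using val_nonneg val_le_M by auto
qed

lemma U_unique:
  assumes "val c \<in> U_q m q" "digits m c" "digits m d" "val d = val c"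
  shows "d = c"
proof -
  obtain z where z: "\<forall>e. digits m e \<longrightarrow> val e = val c \<longrightarrow> e = z"
    using assms(1) unfolding mem_U_iff by blast
  from z assms(3,4) have "d = z" by blast
  moreover from z assms(2) have "c = z" by blast
  ultimately show ?thesis by simp
qed

text \<open>At the first difference from another expansion, a digit gap of at least 1 would have to
  be offset by a tail value in \<open>[0, M]\<close>, which \<open>strict\<close> excludes.\<close>

lemma strict_imp_U:
  assumes c: "digits m c" and "strict c"
  shows "val c \<in> U_q m q"
  unfolding mem_U_iff
proof (intro exI conjI allI impI)
  fix d assume d: "digits m d" "val d = val c"
  show "d = c"
  proof (rule ccontr)
    assume "d \<noteq> c"
    obtain n where ne: "d n \<noteq> c n"
      and eq: "real (d n) + val (shift (Suc n) d) = real (c n) + val (shift (Suc n) c)"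
      by (rule first_difference[OF d(1) c d(2) \<open>d \<noteq> c\<close>]) (rule that)
    have bounds: "d n \<le> m" "c n \<le> m" using c d(1) by (auto simp: digits_def)
    have v: "0 \<le> val (shift (Suc n) d)" "val (shift (Suc n) d) \<le> M"
      using d(1) by (simp_all add: val_nonneg val_le_M)
    show False
    proof (cases "c n < d n")
      case True
      then have "val (shift (Suc n) c) < 1" using \<open>strict c\<close> bounds by (simp add: strict_def)
      with True eq v(1) show False by linarith
    next
      case False
      then have "M - 1 < val (shift (Suc n) c)" using \<open>strict c\<close> ne by (simp add: strict_def)
      with False ne eq v(2) show False by linarith
    qed
  qed
qed (use c in auto)

text \<open>A violated inequality leaves room to change one digit by 1 and to expand the altered
  tail value anew.\<close>

lemma U_imp_strict:
  assumes U: "val c \<in> U_q m q" and c: "digits m c"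
  shows "strict c"
  unfolding strict_def
proof (intro allI conjI impI)
  fix n
  let ?t = "val (shift (Suc n) c)"
  have t: "0 \<le> ?t" "?t \<le> M" using c by (simp_all add: val_nonneg val_le_M)
  have no_other: False if e: "e \<le> m" "e \<noteq> c n" "0 \<le> y" "y \<le> M" "real e + y = real (c n) + ?t" for e y
  proof -
    obtain d where d: "digits m d" "val d = y" using expansion_exists[OF e(3,4)] .
    have "prepend n c (case_nat e d) = c"
      using val_replace[OF c d(1) e(1), of n] e(5) d(2)
      by (intro U_unique[OF U c]) simp_all
    then have "prepend n c (case_nat e d) n = c n" by simp
    then show False using e(2) by (simp add: prepend_def)
  qed
  show "?t < 1" if "c n < m"
    using no_other[of "Suc (c n)" "?t - 1"] that t by fastforce
  show "M - 1 < ?t" if "0 < c n"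
  proof (rule ccontr)
    assume "\<not> M - 1 < ?t"
    moreover have "c n - 1 \<le> m" using c by (simp add: digits_def le_diff_conv le_SucI)
    moreover have "real (c n - 1) + (?t + 1) = real (c n) + ?t" "c n - 1 \<noteq> c n"
      using that by (auto simp: of_nat_diff)
    ultimately show False using no_other[of "c n - 1" "?t + 1"] that t by simp
  qed
qed

section \<open>The endpoints of \<open>I_q\<close>, and bases for which \<open>U_q\<close> contains
  nothing else\<close>

lemma zero_in_U: "0 \<in> U_q m q"
  using strict_imp_U[of "\<lambda>_. 0"] by (simp add: digits_def strict_def shift_def)

lemma M_in_U: "M \<in> U_q m q"
  using strict_imp_U[of "\<lambda>_. m"] by (simp add: digits_def strict_def shift_def)

lemma strict_reflection:
  assumes c: "digits m c" and strict: "strict c"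
  shows "strict (reflection m c)"
  unfolding strict_def
proof (intro allI conjI impI)
  fix n
  have v: "val (shift (Suc n) (reflection m c)) = M - val (shift (Suc n) c)"
    using c by (simp add: val_reflection flip: reflection_shift)
  show "val (shift (Suc n) (reflection m c)) < 1" if "reflection m c n < m"
  proof -
    have "0 < c n" using that by simp
    then have "M - 1 < val (shift (Suc n) c)" using strict unfolding strict_def by blast
    then show ?thesis using v by linarith
  qed
  show "M - 1 < val (shift (Suc n) (reflection m c))" if "0 < reflection m c n"
  proof -
    have "c n < m" using that by simp
    then have "val (shift (Suc n) c) < 1" using strict unfolding strict_def by blast
    then show ?thesis using v by linarith
  qed
qed

lemma weak_reflection:
  assumes c: "digits m c" and weak: "weak c"
  shows "weak (reflection m c)"
  unfolding weak_def
proof (intro allI conjI impI)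
  fix n
  have v: "val (shift (Suc n) (reflection m c)) = M - val (shift (Suc n) c)"
    using c by (simp add: val_reflection flip: reflection_shift)
  show "val (shift (Suc n) (reflection m c)) \<le> 1" if "reflection m c n < m"
  proof -
    have "0 < c n" using that by simp
    then have "M - 1 \<le> val (shift (Suc n) c)" using weak unfolding weak_def by blast
    then show ?thesis using v by linarith
  qed
  show "M - 1 \<le> val (shift (Suc n) (reflection m c))" if "0 < reflection m c n"
  proof -
    have "c n < m" using that by simp
    then have "val (shift (Suc n) c) \<le> 1" using weak unfolding weak_def by blast
    then show ?thesis using v by linarith
  qed
qed

text \<open>After a digit below \<open>m\<close>, a next digit \<open>e\<close> with
  \<open>m \<le> 2 * e\<close> would leave a tail below \<open>q - e\<close>, which is too small; by
  reflection, a positive digit is followed by one exceeding \<open>m / 2\<close>. A digit strictly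
  between 0 and \<open>m\<close> would require both, so the expansion is constantly 0 or constantly
  \<open>m\<close>.\<close>

lemma U_subset_endpoints:
  assumes small: "\<And>e. 0 < e \<Longrightarrow> m \<le> 2 * e \<Longrightarrow> q - real e \<le> M - 1"
  shows "U_q m q \<subseteq> {0, M}"
proof
  fix x assume "x \<in> U_q m q"
  then obtain c where c: "digits m c" "val c = x" unfolding mem_U_iff by blast
  have low: "2 * c (Suc n) < m" if "digits m c" "strict c" "c n < m" for c n
  proof (rule ccontr)
    assume "\<not> 2 * c (Suc n) < m"
    then have e: "0 < c (Suc n)" "m \<le> 2 * c (Suc n)" using m_pos by auto
    have "q * val (shift (Suc n) c) = real (c (Suc n)) + val (shift (Suc (Suc n)) c)"
      using val_Suc[of "shift (Suc n) c"] that(1) by simp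
    moreover have "q * val (shift (Suc n) c) < q * 1"
      using that q_pos by (intro mult_strict_left_mono) (auto simp: strict_def)
    moreover have "M - 1 < val (shift (Suc (Suc n)) c)"
      using that(2) e(1) by (simp add: strict_def)
    ultimately show False using small[OF e] by simp
  qed
  have sc: "strict c" using U_imp_strict[of c] c \<open>x \<in> U_q m q\<close> by simp
  have cm: "c n \<le> m" for n using c(1) by (simp add: digits_def)
  have lo: "2 * c (Suc n) < m" if "c n < m" for n
    using low[OF c(1) sc that] .
  have hi: "m < 2 * c (Suc n)" if "0 < c n" for n
    using low[OF digits_reflection strict_reflection[OF c(1) sc], of n] that cm[of n] cm[of "Suc n"]
    by auto
  have extreme: "c n = 0 \<or> c n = m" for n
    using lo[of n] hi[of n] cm[of n] by linarith
  have "c n = c 0" for n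
  proof (induction n)
    case (Suc n)
    show ?case
      using extreme[of n] extreme[of "Suc n"] lo[of n] hi[of n] m_pos Suc by auto
  qed simp
  then have "c = (\<lambda>_. c 0)" by (rule ext)
  then have "c = (\<lambda>_. 0) \<or> c = (\<lambda>_. m)" using extreme[of 0] by metis
  then show "x \<in> {0, M}" using c(2) by auto
qed

text \<open>The required bound is an equality at the smallest possible \<open>e\<close>, namely
  \<open>k\<close> for \<open>m = 2 * k\<close> and \<open>k + 1\<close> for
  \<open>m = 2 * k + 1\<close>; in the odd case this is the quadratic equation of
  \<open>golden_odd\<close>.\<close>

lemma U_subset_endpoints_golden:
  assumes "q = golden m"
  shows "U_q m q \<subseteq> {0, M}"
proof (rule U_subset_endpoints)
  fix e assume e: "0 < e" "m \<le> 2 * e"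
  have "(q - real e) * (q - 1) \<le> real m - (q - 1)"
  proof (cases "even m")
    case True
    then obtain k where k: "m = 2 * k" by blast
    then have q: "q = real k + 1" using golden_even assms by simp
    have "(q - real e) * (q - 1) \<le> 1 * (q - 1)"
      using e k q by (intro mult_right_mono) auto
    then show ?thesis using k q by simp
  next
    case False
    then obtain k where k: "m = 2 * k + 1" by (blast elim: oddE)
    have sq: "q\<^sup>2 = (real k + 1) * (q + 1)" using golden_odd[OF k q_pos] assms by simp
    have "k + 1 \<le> e" using e k by simp
    then have "(q - real e) * (q - 1) \<le> (q - (real k + 1)) * (q - 1)"
      using q_gt_1 by (intro mult_right_mono) auto
    also have "\<dots> = real m - (q - 1)"
      using sq k by (simp add: power2_eq_square algebra_simps)
    finally show ?thesis .
  qed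
  then show "q - real e \<le> M - 1"
    using q_gt_1 by (simp add: top_val_def field_simps)
qed

text \<open>\<open>2 \<le> M\<close> means \<open>q \<le> m / 2 + 1\<close>, so
  \<open>q - e \<le> 1 \<le> M - 1\<close> whenever \<open>m \<le> 2 * e\<close>.\<close>

lemma U_subset_endpoints_small:
  assumes "2 \<le> M"
  shows "U_q m q \<subseteq> {0, M}"
proof (rule U_subset_endpoints)
  fix e assume e: "0 < e" "m \<le> 2 * e"
  have "2 * (q - 1) \<le> real m" using assms q_gt_1 by (simp add: top_val_def field_simps)
  moreover have "real m \<le> real (2 * e)" using e(2) by (simp only: of_nat_le_iff)
  ultimately have "q - real e \<le> 1" by simp
  then show "q - real e \<le> M - 1" using assms by linarith
qed

text \<open>Two different doubly infinite expansions persist, with perturbed tails, near their value.\<close>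

lemma closure_U_subset_V: "closure (U_q m q) \<subseteq> V_q m q"
proof
  fix x assume x: "x \<in> closure (U_q m q)"
  have "closure (U_q m q) \<subseteq> I_q m q"
    by (rule closure_minimal) (auto simp: U_q_def I_q_def)
  then have xI: "x \<in> I_q m q" using x by blast
  have contra: False if cd: "digits m c" "digits m d" "val c = x" "val d = x"
      "doubly_infinite m c" "doubly_infinite m d" "c n < d n"
      "real (c n) + val (shift (Suc n) c) = real (d n) + val (shift (Suc n) d)" for c d n
  proof -
    let ?s = "val (shift (Suc n) c)" and ?t = "val (shift (Suc n) d)"
    have "0 < ?t" "?s < M" "0 \<le> ?s" "?t \<le> M"
      using doubly_infinite_val[of "shift (Suc n) d"] doubly_infinite_val[of "shift (Suc n) c"] cd
      by (simp_all add: doubly_infinite_shift val_nonneg val_le_M)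
    moreover have "?t < ?s" using cd(7,8) by simp
    \<comment> \<open>The room for moving both tail values by the same amount within
      \<open>[0, M]\<close>. As \<open>?t < ?s\<close>, the distances of \<open>?t\<close> from 0
      and of \<open>?s\<close> from \<open>M\<close> are the critical ones.\<close>
    moreover define \<epsilon> where "\<epsilon> = min ?t (M - ?s)"
    ultimately have \<epsilon>: "0 < \<epsilon>" "\<epsilon> \<le> ?t" "?s + \<epsilon> \<le> M" "\<epsilon> \<le> ?s" "?t + \<epsilon> \<le> M" by auto
    have qn: "0 < q ^ Suc n" using q_pos by simp
    obtain y where y: "y \<in> U_q m q" "dist y x < \<epsilon> / q ^ Suc n"
      using x \<epsilon>(1) qn unfolding closure_approachable by (meson divide_pos_pos)
    define \<delta> where "\<delta> = (y - x) * q ^ Suc n"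
    have "\<bar>y - x\<bar> * q ^ Suc n < \<epsilon>"
      using y(2) qn by (simp add: dist_real_def pos_less_divide_eq del: power_Suc)
    then have "\<bar>\<delta>\<bar> < \<epsilon>" unfolding \<delta>_def abs_mult using qn by (simp del: power_Suc)
    then have \<delta>: "0 \<le> ?s + \<delta>" "?s + \<delta> \<le> M" "0 \<le> ?t + \<delta>" "?t + \<delta> \<le> M" using \<epsilon> by auto
    have yx: "y = x + \<delta> / q ^ Suc n" using qn by (simp add: \<delta>_def del: power_Suc)
    obtain c' where c': "digits m c'" "val c' = ?s + \<delta>" using expansion_exists[OF \<delta>(1,2)] .
    obtain d' where d': "digits m d'" "val d' = ?t + \<delta>" using expansion_exists[OF \<delta>(3,4)] .
    have le: "c n \<le> m" "d n \<le> m" using cd by (auto simp: digits_def)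
    obtain z where z: "\<forall>e. digits m e \<longrightarrow> val e = y \<longrightarrow> e = z"
      using y(1) unfolding mem_U_iff by blast
    have "val (prepend n c (case_nat (c n) c')) = y" "val (prepend n d (case_nat (d n) d')) = y"
      using val_replace(1)[OF cd(1) c'(1) le(1), of n] val_replace(1)[OF cd(2) d'(1) le(2), of n]
      by (simp_all only: c'(2) d'(2) cd(3,4) yx) simp_all
    then have "prepend n c (case_nat (c n) c') = z" "prepend n d (case_nat (d n) d') = z"
      using z val_replace(2)[OF cd(1) c'(1) le(1)] val_replace(2)[OF cd(2) d'(1) le(2)] by blast+
    then have "prepend n c (case_nat (c n) c') = prepend n d (case_nat (d n) d')" by simp
    then have "prepend n c (case_nat (c n) c') n = prepend n d (case_nat (d n) d') n" by simp
    then show False using cd(7) by (simp add: prepend_def)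
  qed
  show "x \<in> V_q m q"
    unfolding V_q_def is_expansion_iff
  proof (intro CollectI conjI xI Uniq_I)
    fix c d
    assume *: "(digits m c \<and> val c = x) \<and> doubly_infinite m c"
      "(digits m d \<and> val d = x) \<and> doubly_infinite m d"
    show "c = d"
    proof (rule ccontr)
      assume "c \<noteq> d"
      then obtain n where "c n \<noteq> d n"
        "real (c n) + val (shift (Suc n) c) = real (d n) + val (shift (Suc n) d)"
        using first_difference[of c d] * by metis
      with * contra[of c d n] contra[of d c n] show False
        by (metis linorder_neqE_nat)
    qed
  qed
qed

text \<open>As in \<open>U_imp_strict\<close>, but the altered tail value must lie in the open
  interval for the competing expansion to be doubly infinite; hence only weak inequalities
  result.\<close>

lemma V_imp_weak:
  assumes q: "q < real m + 1" and V: "val c \<in> V_q m q" and c: "digits m c" "doubly_infinite m c"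
  shows "weak c"
  unfolding weak_def
proof (intro allI conjI impI)
  fix n
  let ?t = "val (shift (Suc n) c)"
  have t: "0 < ?t" "?t < M"
    using doubly_infinite_val[of "shift (Suc n) c"] c by (simp_all add: doubly_infinite_shift)
  have no_other: False if e: "e \<le> m" "e \<noteq> c n" "0 < y" "y < M" "real e + y = real (c n) + ?t" for e y
  proof -
    obtain d where d: "digits m d" "val d = y" "doubly_infinite m d"
      using doubly_infinite_exists[OF q e(3,4)] .
    have "digits m (prepend n c (case_nat e d))" "val (prepend n c (case_nat e d)) = val c"
      "doubly_infinite m (prepend n c (case_nat e d))"
      using val_replace[OF c(1) d(1) e(1), of n] e(5) d(2) doubly_infinite_prepend[OF d(3)]
      by simp_all
    with V c have "prepend n c (case_nat e d) = c"
      unfolding V_q_def is_expansion_iff Uniq_def by blast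
    then have "prepend n c (case_nat e d) n = c n" by simp
    then show False using e(2) by (simp add: prepend_def)
  qed
  show "?t \<le> 1" if "c n < m"
    using no_other[of "Suc (c n)" "?t - 1"] that t by fastforce
  show "M - 1 \<le> ?t" if "0 < c n"
  proof (rule ccontr)
    assume "\<not> M - 1 \<le> ?t"
    moreover have "c n - 1 \<le> m" using c by (simp add: digits_def le_diff_conv le_SucI)
    moreover have "real (c n - 1) + (?t + 1) = real (c n) + ?t" "c n - 1 \<noteq> c n"
      using that by (auto simp: of_nat_diff)
    ultimately show False using no_other[of "c n - 1" "?t + 1"] that t by simp
  qed
qed

end

subsection \<open>From quasi-admissible sequences to differences equal to 1\<close>

context expansion_base
begin

text \<open>Parry's argument: the supremum \<open>s\<close> of the tails in question satisfies
  \<open>s - 1 \<le> (s - 1) / q\<close> as soon as \<open>s > 1\<close>.\<close>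

lemma val_less_1:
  assumes \<alpha>: "digits m \<alpha>" "val \<alpha> = 1" "infinite_seq \<alpha>" and c: "digits m c"
    and less: "\<And>n. c n < m \<Longrightarrow> shift (Suc n) c <\<^sub>l \<alpha>"
    and n: "c n < m"
  shows "val (shift (Suc n) c) < 1"
proof -
  define S where "S = {val (shift (Suc n) c) | n. c n < m}"
  \<comment> \<open>Where the tail first falls below \<alpha> it loses at least 1, while the tail of
    \<alpha> is positive. So its excess over 1 is less than that of a later tail from
    \<open>S\<close> divided by a power of \<open>q\<close>.\<close>
  have step: "\<exists>y\<in>S. \<exists>k. val (shift (Suc i) c) - 1 < (y - 1) / q ^ Suc k" if i: "c i < m" for i
  proof -
    let ?x = "shift (Suc i) c"
    obtain k where k: "lex_at k ?x \<alpha>" using less[OF i] by (auto simp: lex_less_def)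
    define y where "y = val (shift (Suc k) ?x)"
    have "\<alpha> k \<le> m" using \<alpha>(1) by (simp add: digits_def)
    then have "c (Suc i + k) < m" using k by (simp add: lex_at_def)
    then have "y \<in> S" unfolding S_def y_def
      by (intro CollectI exI[of _ "Suc i + k"]) simp
    have pre: "(\<Sum>j<k. real (?x j) / q ^ Suc j) = (\<Sum>j<k. real (\<alpha> j) / q ^ Suc j)"
      using k by (intro sum.cong) (auto simp: lex_at_def)
    have "0 < val (shift (Suc k) \<alpha>)"
      using \<alpha> by (intro infinite_seq_val_pos infinite_seq_shift) auto
    moreover have "real (?x k) + 1 \<le> real (\<alpha> k)" using k by (simp add: lex_at_def)
    ultimately have "real (?x k) + y - (real (\<alpha> k) + val (shift (Suc k) \<alpha>)) < y - 1" by linarith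
    then have "(real (?x k) + y - (real (\<alpha> k) + val (shift (Suc k) \<alpha>))) / q ^ Suc k < (y - 1) / q ^ Suc k"
      using q_pos by (intro divide_strict_right_mono) auto
    moreover have "val ?x - val \<alpha> = (real (?x k) + y - (real (\<alpha> k) + val (shift (Suc k) \<alpha>))) / q ^ Suc k"
      using val_split_Suc[OF digits_shift[OF c], of "Suc i" k] val_split_Suc[OF \<alpha>(1), of k] pre
      by (simp only: y_def diff_divide_distrib)
    ultimately show ?thesis using \<open>y \<in> S\<close> \<alpha>(2) by auto
  qed
  have bdd: "bdd_above S" unfolding S_def
    using c by (intro bdd_aboveI[of _ M]) (auto simp: val_le_M)
  define s where "s = Sup S"
  have up: "y \<le> s" if "y \<in> S" for y unfolding s_def using that bdd by (rule cSup_upper)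
  have "s \<le> 1"
  proof (rule ccontr)
    assume "\<not> s \<le> 1"
    then have s: "1 < s" by simp
    have "x \<le> 1 + (s - 1) / q" if x: "x \<in> S" for x
    proof -
      obtain i where i: "x = val (shift (Suc i) c)" "c i < m" using x unfolding S_def by blast
      obtain y k where y: "y \<in> S" "x - 1 < (y - 1) / q ^ Suc k" using step[OF i(2)] i(1) by blast
      have "(y - 1) / q ^ Suc k \<le> (s - 1) / q ^ Suc k"
        using up[OF y(1)] q_pos by (intro divide_right_mono) auto
      also have "\<dots> \<le> (s - 1) / q"
      proof (rule divide_left_mono)
        show "q \<le> q ^ Suc k" using self_le_power[of q "Suc k"] q_gt_1 by simp
      qed (use s q_pos in auto)
      finally show ?thesis using y(2) by simp
    qed
    moreover have "S \<noteq> {}" using n by (auto simp: S_def)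
    ultimately have "s \<le> 1 + (s - 1) / q" unfolding s_def by (intro cSup_least) auto
    moreover have "(s - 1) / q < s - 1"
      using mult_strict_left_mono[of 1 q "s - 1"] s q_gt_1 by (simp add: divide_less_eq)
    ultimately show False by simp
  qed
  \<comment> \<open>The supremum gives only a weak bound; one more use of \<open>step\<close> makes
    it strict for this tail.\<close>
  obtain y k where y: "y \<in> S" "val (shift (Suc n) c) - 1 < (y - 1) / q ^ Suc k"
    using step[OF n] by blast
  have "(y - 1) / q ^ Suc k \<le> 0"
    using up[OF y(1)] \<open>s \<le> 1\<close> q_pos by (intro divide_nonpos_pos) auto
  then show ?thesis using y(2) by simp
qed

text \<open>The lower bounds in \<open>strict\<close> are the upper bounds of
  \<open>val_less_1\<close> for the reflection.\<close>

lemma univoque_imp_U: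
  assumes \<alpha>: "digits m \<alpha>" "val \<alpha> = 1" "infinite_seq \<alpha>" and u: "univoque m \<alpha> c"
  shows "val c \<in> U_q m q"
proof (rule strict_imp_U)
  show c: "digits m c" using u by (simp add: univoque_def)
  have r: "univoque m \<alpha> (reflection m c)" using u by (rule univoque_reflection)
  show "strict c"
    unfolding strict_def
  proof (intro allI conjI impI)
    fix n
    show "val (shift (Suc n) c) < 1" if "c n < m"
      using u that by (intro val_less_1[OF \<alpha> c]) (auto simp: univoque_def)
    assume "0 < c n"
    then have "reflection m c n < m" using m_pos by simp
    then have "val (shift (Suc n) (reflection m c)) < 1"
      using r by (intro val_less_1[OF \<alpha> digits_reflection]) (auto simp: univoque_def)
    then show "M - 1 < val (shift (Suc n) c)"
      using c by (simp add: val_reflection flip: reflection_shift)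
  qed
qed

text \<open>If \<open>c\<close> first exceeds \<alpha> at \<open>k\<close>, it gains at least 1
  there, while the tail of \<alpha> is worth at most 1 and the infinite tail of \<open>c\<close> is
  positive; then \<open>val c\<close> would exceed 1.\<close>

lemma lex_le_of_val_le_1:
  assumes \<alpha>: "digits m \<alpha>" "val \<alpha> = 1" "\<And>n. \<alpha> n < m \<Longrightarrow> val (shift (Suc n) \<alpha>) \<le> 1"
    and c: "digits m c" "infinite_seq c" "val c \<le> 1"
  shows "c \<le>\<^sub>l \<alpha>"
proof (rule ccontr)
  assume "\<not> c \<le>\<^sub>l \<alpha>"
  then obtain k where k: "lex_at k \<alpha> c" using lex_total[of c \<alpha>] by (auto simp: lex_less_def)
  have pre: "(\<Sum>j<k. real (c j) / q ^ Suc j) = (\<Sum>j<k. real (\<alpha> j) / q ^ Suc j)"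
    using k by (intro sum.cong) (auto simp: lex_at_def)
  have "c k \<le> m" using c(1) by (simp add: digits_def)
  then have "val (shift (Suc k) \<alpha>) \<le> 1" using k by (intro \<alpha>(3)) (simp add: lex_at_def)
  moreover have "0 < val (shift (Suc k) c)"
    using c by (intro infinite_seq_val_pos infinite_seq_shift) auto
  moreover have "real (\<alpha> k) + 1 \<le> real (c k)" using k by (simp add: lex_at_def)
  ultimately have "real (\<alpha> k) + val (shift (Suc k) \<alpha>) < real (c k) + val (shift (Suc k) c)" by linarith
  then have "(real (\<alpha> k) + val (shift (Suc k) \<alpha>)) / q ^ Suc k < (real (c k) + val (shift (Suc k) c)) / q ^ Suc k"
    using q_pos by (intro divide_strict_right_mono) auto
  then show False
    using val_split_Suc[OF c(1), of k] val_split_Suc[OF \<alpha>(1), of k] pre c(3) \<alpha>(2) by linarith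
qed

lemma weak_imp_quasi_admissible:
  assumes \<alpha>: "digits m \<alpha>" "val \<alpha> = 1" "doubly_infinite m \<alpha>" "weak \<alpha>"
  shows "quasi_admissible m \<alpha>"
  unfolding quasi_admissible_def
proof (intro conjI allI impI)
  have tails: "val (shift (Suc n) \<alpha>) \<le> 1" if "\<alpha> n < m" for n
    using \<alpha>(4) that by (simp add: weak_def)
  have inf: "infinite_seq (shift (Suc n) \<alpha>)" "infinite_seq (reflection m (shift (Suc n) \<alpha>))" for n
    using doubly_infinite_shift[OF \<alpha>(3)] by (simp_all add: doubly_infinite_def)
  fix n
  show "shift (Suc n) \<alpha> \<le>\<^sub>l \<alpha>" if "\<alpha> n < m"
    using \<alpha>(1) tails that by (intro lex_le_of_val_le_1[OF \<alpha>(1,2)] inf) auto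
  assume "0 < \<alpha> n"
  then have "M - 1 \<le> val (shift (Suc n) \<alpha>)"
    using \<alpha>(4) unfolding weak_def by blast
  then have "val (reflection m (shift (Suc n) \<alpha>)) \<le> 1"
    using \<alpha>(1) by (simp add: val_reflection)
  then show "reflection m (shift (Suc n) \<alpha>) \<le>\<^sub>l \<alpha>"
    using tails by (intro lex_le_of_val_le_1[OF \<alpha>(1,2)] inf) auto
qed (rule \<alpha>(1))

text \<open>By periodicity the first \<open>N\<close> digits of \<alpha> with the last one raised
  are worth exactly 1, since the added \<open>1 / q ^ N\<close> replaces the contribution of the
  tail. The common tail \<open>d\<close> cancels in the difference.\<close>

lemma one_in_diff_set_of_pair:
  assumes \<alpha>: "digits m \<alpha>" "val \<alpha> = 1" "infinite_seq \<alpha>" and N: "1 \<le> N" "shift N \<alpha> = \<alpha>"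
    and a: "univoque m \<alpha> (prepend N (\<alpha>(N - 1 := Suc (\<alpha> (N - 1)))) d)"
    and b: "univoque m \<alpha> (prepend N (\<lambda>_. 0) d)"
  shows "1 \<in> diff_set (U_q m q) (U_q m q)"
proof -
  let ?\<beta> = "\<alpha>(N - 1 := Suc (\<alpha> (N - 1)))"
  obtain p where p: "N = Suc p" using N(1) by (metis Suc_le_D One_nat_def)
  have "val (prepend N ?\<beta> d) = (\<Sum>i<N. real (?\<beta> i) / q ^ Suc i) + val d / q ^ N"
    using val_split[of "prepend N ?\<beta> d" N] a
    by (simp add: univoque_def shift_prepend_ge) (simp add: prepend_def)
  moreover have "val (prepend N (\<lambda>_. 0) d) = val d / q ^ N"
    using val_split[of "prepend N (\<lambda>_. 0) d" N] b
    by (simp add: univoque_def shift_prepend_ge) (simp add: prepend_def)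
  moreover have "(\<Sum>i<N. real (?\<beta> i) / q ^ Suc i) = (\<Sum>i<N. real (\<alpha> i) / q ^ Suc i) + 1 / q ^ N"
    by (simp add: p add_divide_distrib)
  moreover have "(\<Sum>i<N. real (\<alpha> i) / q ^ Suc i) + 1 / q ^ N = 1"
    using val_split[OF \<alpha>(1), of N] N(2) \<alpha>(2) by simp
  ultimately have "1 = val (prepend N ?\<beta> d) - val (prepend N (\<lambda>_. 0) d)" by simp
  then show ?thesis
    unfolding diff_set_def using univoque_imp_U[OF \<alpha> a] univoque_imp_U[OF \<alpha> b] by blast
qed

lemma one_in_diff_set_of_quasi_expansion:
  assumes \<alpha>: "digits m \<alpha>" "val \<alpha> = 1" "doubly_infinite m \<alpha>" "weak \<alpha>"
    and "q \<noteq> golden m"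
  shows "1 \<in> diff_set (U_q m q) (U_q m q)"
proof -
  have inf: "infinite_seq \<alpha>" using \<alpha>(3) by (simp add: doubly_infinite_def)
  have qa: "quasi_admissible m \<alpha>" using \<alpha> by (rule weak_imp_quasi_admissible)
  have \<alpha>m: "\<alpha> i \<le> m" for i using \<alpha>(1) by (simp add: digits_def)
  have up0: "\<alpha> (Suc i) \<le> \<alpha> 0" if "\<alpha> i < m" for i
    using lex_first[of "shift (Suc i) \<alpha>" \<alpha> 0] quasi_admissibleD(2)[OF qa, of "Suc i"] that by simp
  have lo0: "m - \<alpha> (Suc i) \<le> \<alpha> 0" if "0 < \<alpha> i" for i
    using lex_first[of "reflection m (shift (Suc i) \<alpha>)" \<alpha> 0] quasi_admissibleD(3)[OF qa, of "Suc i"] that by simp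
  have pos: "0 < \<alpha> 0"
  proof (rule ccontr)
    assume "\<not> 0 < \<alpha> 0"
    then have "\<alpha> i = 0" for i
      by (induction i) (use up0 m_pos in fastforce)+
    then have "\<alpha> = (\<lambda>_. 0)" by (rule ext)
    then show False using \<alpha>(2) by simp
  qed
  have ge: "m \<le> 2 * \<alpha> 0"
    using lo0[OF pos] up0[of 0] \<alpha>m[of 0] by (cases "\<alpha> 0 < m") auto
  \<comment> \<open>Equality would force a constant \<alpha> and thus
    \<open>q = \<alpha> 0 + 1\<close>, the golden value for even \<open>m\<close>.\<close>
  have large: "m < 2 * \<alpha> 0"
  proof (rule ccontr)
    assume "\<not> m < 2 * \<alpha> 0"
    then have m: "m = 2 * \<alpha> 0" using ge by simp
    have "\<alpha> i = \<alpha> 0" for i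
    proof (induction i)
      case (Suc i)
      then have "\<alpha> i < m" "0 < \<alpha> i" using m pos by auto
      then show ?case using up0[of i] lo0[of i] m by simp
    qed simp
    then have "\<alpha> = (\<lambda>_. \<alpha> 0)" by (rule ext)
    then have "val (\<lambda>_. \<alpha> 0) = 1" using \<alpha>(2) by simp
    then have "q = real (\<alpha> 0) + 1" unfolding val_const using q_gt_1 by (simp add: field_simps)
    then show False using golden_even[OF m] assms(5) by simp
  qed
  show ?thesis
  proof (cases "univoque m \<alpha> \<alpha>")
    case True
    then have "1 \<in> U_q m q" using univoque_imp_U[OF \<alpha>(1,2) inf True] \<alpha>(2) by simp
    then show ?thesis unfolding diff_set_def using zero_in_U by force
  next
    case False
    \<comment> \<open>If a quasi-admissible \<alpha> is not univoque, one of its inequalities is an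
      equality; the least index with this property supplies the assumptions
      \<open>first\<close>.\<close>
    define P where "P j \<longleftrightarrow> 1 \<le> j \<and> (\<alpha> (j - 1) < m \<and> shift j \<alpha> = \<alpha> \<or>
        0 < \<alpha> (j - 1) \<and> reflection m (shift j \<alpha>) = \<alpha>)" for j
    obtain i where "\<alpha> i < m \<and> \<not> shift (Suc i) \<alpha> <\<^sub>l \<alpha> \<or> 0 < \<alpha> i \<and> \<not> reflection m (shift (Suc i) \<alpha>) <\<^sub>l \<alpha>"
      using False \<alpha>(1) unfolding univoque_def by blast
    then have "P (Suc i)"
      using qa unfolding quasi_admissible_def lex_le_def P_def by auto
    define n where "n = (LEAST j. P j)"
    have Pn: "P n" unfolding n_def using \<open>P (Suc i)\<close> by (rule LeastI)
    have least: "\<not> P j" if "j < n" for j using that unfolding n_def by (rule not_less_Least)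
    have n: "1 \<le> n" using Pn by (simp add: P_def)
    have first: "shift j \<alpha> \<noteq> \<alpha>" if "1 \<le> j" "j < n" "\<alpha> (j - 1) < m" for j
      using least[OF that(2)] that by (simp add: P_def)
    have first': "reflection m (shift j \<alpha>) \<noteq> \<alpha>" if "1 \<le> j" "j < n" "0 < \<alpha> (j - 1)" for j
      using least[OF that(2)] that by (simp add: P_def)
    consider "\<alpha> (n - 1) < m" "shift n \<alpha> = \<alpha>" | "0 < \<alpha> (n - 1)" "reflection m (shift n \<alpha>) = \<alpha>"
      using Pn unfolding P_def by meson
    then show ?thesis
    proof cases
      case 1
      show ?thesis
        using univoque_pair_periodic[OF qa n first first' 1(2,1) large]
          one_in_diff_set_of_pair[OF \<alpha>(1,2) inf n 1(2)] by blast
    next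
      case 2
      \<comment> \<open>Otherwise \<alpha> alternates between \<open>k + 1\<close> and
        \<open>k\<close>, and \<open>val \<alpha> = 1\<close> becomes the quadratic equation of the
        golden value for odd \<open>m\<close>.\<close>
      have critical: "m + 1 < 2 * \<alpha> 0" if "n = 1"
      proof (rule ccontr)
        assume "\<not> m + 1 < 2 * \<alpha> 0"
        then have m: "m + 1 = 2 * \<alpha> 0" using large by simp
        define k where "k = \<alpha> 0 - 1"
        have k: "\<alpha> 0 = k + 1" "m = 2 * k + 1" using m pos by (auto simp: k_def)
        have refl: "\<alpha> i = m - \<alpha> (Suc i)" for i
          using fun_cong[OF 2(2), of i] that by simp
        have \<alpha>1: "\<alpha> 1 = k" using refl[of 0] \<alpha>m[of 1] k by simp
        have "shift 2 \<alpha> = \<alpha>"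
        proof
          fix i
          show "shift 2 \<alpha> i = \<alpha> i"
            using refl[of i] refl[of "Suc i"] \<alpha>m[of "Suc (Suc i)"] by simp
        qed
        then have "val \<alpha> = (\<Sum>i<2. real (\<alpha> i) / q ^ Suc i) + val \<alpha> / q ^ 2"
          using val_split[OF \<alpha>(1), of 2] by simp
        then have "1 = (real k + 1) / q + real k / q\<^sup>2 + 1 / q\<^sup>2"
          using \<alpha>(2) k(1) \<alpha>1 by (simp add: numeral_2_eq_2 add.commute)
        then have "q\<^sup>2 = (real k + 1) * (q + 1)"
          using q_pos by (simp add: field_simps power2_eq_square)
        then show False using golden_odd[OF k(2) q_pos] assms(5) by simp
      qed
      have "shift n \<alpha> = reflection m \<alpha>"
        using 2(2) \<alpha>(1) by (metis digits_shift reflection_reflection)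
      then have "shift (2 * n) \<alpha> = \<alpha>"
        using 2(2) by (metis mult_2 reflection_shift shift_shift)
      then show ?thesis
        using univoque_pair_antiperiodic[OF qa n first first' 2(2,1) large critical] n
          one_in_diff_set_of_pair[OF \<alpha>(1,2) inf, of "2 * n"] by fastforce
    qed
  qed
qed

text \<open>An element of \<open>V_q\<close> outside \<open>U_q\<close> has a doubly infinite
  expansion that is weak but not strict, so some tail value is exactly 1 or \<open>M - 1\<close>.
  That tail or its reflection is a doubly infinite weak expansion of 1.\<close>

lemma diff_set_V_imp_diff_set_U:
  assumes q: "q < real m + 1" and "q \<noteq> golden m" and "1 \<in> diff_set (V_q m q) (V_q m q)"
  shows "1 \<in> diff_set (U_q m q) (U_q m q)"
proof (cases "V_q m q \<subseteq> U_q m q")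
  case True
  then show ?thesis using assms(3) unfolding diff_set_def by blast
next
  case False
  then obtain x where x: "x \<in> V_q m q" "x \<notin> U_q m q" by blast
  then have "x \<noteq> 0" "x \<noteq> M" "x \<in> {0..M}"
    using zero_in_U M_in_U I_q_eq by (auto simp: V_q_def)
  then obtain c where c: "digits m c" "val c = x" "doubly_infinite m c"
    using doubly_infinite_exists[OF q, of x] by force
  have weak: "weak c" using V_imp_weak[OF q] c x(1) by simp
  have "\<not> strict c" using strict_imp_U c x(2) by blast
  then obtain n where n: "c n < m \<and> \<not> val (shift (Suc n) c) < 1 \<or>
      0 < c n \<and> \<not> M - 1 < val (shift (Suc n) c)"
    unfolding strict_def by blast
  let ?t = "shift (Suc n) c"
  have t: "digits m ?t" "doubly_infinite m ?t" "weak ?t"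
    using c weak by (simp_all add: doubly_infinite_shift) (simp add: weak_def)
  have "c n < m \<longrightarrow> val ?t \<le> 1" "0 < c n \<longrightarrow> M - 1 \<le> val ?t"
    using weak unfolding weak_def by blast+
  with n have "val ?t = 1 \<or> val ?t = M - 1"
    by (metis linorder_neqE_linordered_idom not_less)
  then show ?thesis
  proof
    assume "val ?t = 1"
    with t assms(2) show ?thesis by (intro one_in_diff_set_of_quasi_expansion)
  next
    assume "val ?t = M - 1"
    then have "val (reflection m ?t) = 1" using val_reflection[OF t(1)] by simp
    moreover have "weak (reflection m ?t)"
      using t(1,3) by (rule weak_reflection)
    moreover have "doubly_infinite m (reflection m ?t)"
      using t(1,2) by (rule doubly_infinite_reflection)
    ultimately show ?thesis
      using assms(2) by (intro one_in_diff_set_of_quasi_expansion) auto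
  qed
qed

end

subsection \<open>Numbers with exactly two expansions\<close>

context expansion_base
begin

text \<open>Where the two expansions part, their digits are neighbours, since an intermediate digit
  would allow a third expansion. Each tail there is unique for the same reason.\<close>

lemma B2_imp_diff_set:
  assumes "q \<in> B2 m"
  shows "1 \<in> diff_set (U_q m q) (U_q m q)"
proof -
  obtain x where "card {c. is_expansion m q x c} = 2"
    using assms unfolding B2_def by blast
  then have "card {c. digits m c \<and> val c = x} = 2"
    by (simp only: is_expansion_iff)
  then obtain c0 d0 where E0: "{c. digits m c \<and> val c = x} = {c0, d0}" "c0 \<noteq> d0"
    by (meson card_2_iff)
  have c0: "digits m c0" "val c0 = x" and d0: "digits m d0" "val d0 = x" using E0(1) by auto
  have vals: "val c0 = val d0" using c0 d0 by simp
  obtain n where n: "c0 n \<noteq> d0 n"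
    "real (c0 n) + val (shift (Suc n) c0) = real (d0 n) + val (shift (Suc n) d0)"
    using first_difference[OF c0(1) d0(1) vals E0(2)] by metis
  have "\<exists>c d. {c. digits m c \<and> val c = x} = {c, d} \<and> c n < d n \<and>
      real (c n) + val (shift (Suc n) c) = real (d n) + val (shift (Suc n) d)"
  proof (cases "c0 n < d0 n")
    case True
    with E0(1) n(2) show ?thesis by blast
  next
    case False
    then have "{c. digits m c \<and> val c = x} = {d0, c0}" "d0 n < c0 n"
      "real (d0 n) + val (shift (Suc n) d0) = real (c0 n) + val (shift (Suc n) c0)"
      using E0(1) n by auto
    then show ?thesis by blast
  qed
  then obtain c d where E: "{c. digits m c \<and> val c = x} = {c, d}" "c n < d n"
    and eq: "real (c n) + val (shift (Suc n) c) = real (d n) + val (shift (Suc n) d)"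
    by blast
  have c: "digits m c" "val c = x" and d: "digits m d" "val d = x" using E(1) by auto
  have le: "c n \<le> m" "d n \<le> m" using c d by (auto simp: digits_def)
  have mem: "prepend n z (case_nat e y) = c \<or> prepend n z (case_nat e y) = d"
    if "digits m z" "val z = x" "digits m y" "e \<le> m"
      "real e + val y = real (z n) + val (shift (Suc n) z)" for z y e
  proof -
    have "prepend n z (case_nat e y) \<in> {c. digits m c \<and> val c = x}"
      using val_replace[OF that(1,3,4), of n] that(2,5) by simp
    then show ?thesis unfolding E(1) by blast
  qed
  have digit: "prepend n z (case_nat e y) n = e" for z y e by (simp add: prepend_def)
  have tail: "shift (Suc n) (prepend n z (case_nat e y)) = y" for z y e
    by (simp add: shift_prepend_ge Suc_diff_le) (simp add: shift_def)
  have next_digit: "d n = Suc (c n)"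
  proof (rule ccontr)
    assume "d n \<noteq> Suc (c n)"
    then have gap: "Suc (c n) < d n" using E(2) by simp
    then have "real (c n) + 2 \<le> real (d n)" by linarith
    then have "0 \<le> val (shift (Suc n) c) - 1" "val (shift (Suc n) c) - 1 \<le> M"
      using eq val_nonneg[of "shift (Suc n) d"] val_le_M[of "shift (Suc n) c"] c d by auto
    then obtain y where y: "digits m y" "val y = val (shift (Suc n) c) - 1"
      by (rule expansion_exists)
    then have "prepend n c (case_nat (Suc (c n)) y) = c \<or> prepend n c (case_nat (Suc (c n)) y) = d"
      using gap le by (intro mem c) auto
    then show False
    proof
      assume "prepend n c (case_nat (Suc (c n)) y) = c"
      from fun_cong[OF this, of n] show False by (simp only: digit)
    next
      assume "prepend n c (case_nat (Suc (c n)) y) = d"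
      from fun_cong[OF this, of n] show False using gap by (simp only: digit)
    qed
  qed
  have U: "val (shift (Suc n) z) \<in> U_q m q" if z: "z = c \<or> z = d" for z
    unfolding mem_U_iff
  proof (intro exI conjI allI impI)
    have zx: "digits m z" "val z = x" "z n \<le> m" using z c d le by auto
    show "digits m (shift (Suc n) z)" using zx by simp
    fix y assume y: "digits m y" "val y = val (shift (Suc n) z)"
    define w where "w = prepend n z (case_nat (z n) y)"
    \<comment> \<open>Replacing the tail of \<open>z\<close> yields one of the two expansions; the
      digit at \<open>n\<close> identifies it as \<open>z\<close>.\<close>
    have w: "w = c \<or> w = d" "w n = z n"
      unfolding w_def using y zx by (intro mem; simp) (rule digit)
    then have "w = z" using z E(2) by auto
    have "y = shift (Suc n) w" unfolding w_def by (rule tail[symmetric])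
    then show "y = shift (Suc n) z" unfolding \<open>w = z\<close> .
  qed simp
  have "1 = val (shift (Suc n) c) - val (shift (Suc n) d)" using eq next_digit by simp
  then show ?thesis
    unfolding diff_set_def by (intro CollectI exI conjI) (use U in auto)
qed

text \<open>The number \<open>(k + a) / q\<close> can start with \<open>k\<close>, followed by the
  expansion of \<open>a\<close>, or with \<open>k + 1\<close>, followed by that of \<open>b\<close>.
  A smaller first digit would need a tail worth at least \<open>a + 1\<close>, a larger one a tail
  worth at most \<open>b - 1\<close>; the assumptions on \<open>k\<close> exclude both.\<close>

lemma B2_of_difference:
  assumes a: "a \<in> U_q m q" and b: "b \<in> U_q m q" and ab: "a - b = 1"
    and k: "Suc k \<le> m" "k = 0 \<or> M < a + 1" "Suc k = m \<or> b < 1"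
  shows "q \<in> B2 m"
proof -
  obtain c where c: "digits m c" "val c = a" "\<forall>e. digits m e \<longrightarrow> val e = a \<longrightarrow> e = c"
    using a unfolding mem_U_iff by blast
  obtain d where d: "digits m d" "val d = b" "\<forall>e. digits m e \<longrightarrow> val e = b \<longrightarrow> e = d"
    using b unfolding mem_U_iff by blast
  define x where "x = (real k + a) / q"
  have tail: "shift 1 (case_nat e z) = z" for e :: nat and z by (simp add: shift_def)
  have qval: "q * val (case_nat e z) = real e + val z" if "e \<le> m" "digits m z" for e z
    using val_Suc[of "case_nat e z"] that digits_case_nat tail by simp
  have x_iff: "val z = x \<longleftrightarrow> q * val z = real k + a" for z
    using q_pos by (auto simp: x_def field_simps)
  have dig: "digits m (case_nat k c)" "digits m (case_nat (Suc k) d)"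
    using k(1) c(1) d(1) by (simp_all add: digits_case_nat)
  have vals: "val (case_nat k c) = x" "val (case_nat (Suc k) d) = x"
    unfolding x_iff using qval[of k c] qval[of "Suc k" d] k(1) c(1,2) d(1,2) ab by auto
  have only: "e = case_nat k c \<or> e = case_nat (Suc k) d" if e: "digits m e" "val e = x" for e
  proof -
    have eq: "real k + a = real (e 0) + val (shift 1 e)" using val_Suc[OF e(1)] iffD1[OF x_iff e(2)] by simp
    have v: "0 \<le> val (shift 1 e)" "val (shift 1 e) \<le> M" using e(1) by (simp_all add: val_nonneg val_le_M)
    have em: "e 0 \<le> m" using e(1) by (simp add: digits_def)
    have e_eq: "e = case_nat (e 0) (shift 1 e)"
      by (auto simp: shift_def fun_eq_iff split: nat.split)
    have ge: "k \<le> e 0"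
    proof (rule ccontr)
      assume "\<not> k \<le> e 0"
      then have "real (e 0) + 1 \<le> real k" "k \<noteq> 0" by auto
      then show False using k(2) eq v by auto
    qed
    have le: "e 0 \<le> Suc k"
    proof (rule ccontr)
      assume "\<not> e 0 \<le> Suc k"
      then have "real k + 2 \<le> real (e 0)" "Suc k \<noteq> m" using em by auto
      then show False using k(3) eq v ab by auto
    qed
    show ?thesis
    proof (cases "e 0 = k")
      case True
      then have "val (shift 1 e) = a" using eq by simp
      then have "shift 1 e = c" using c(3) e(1) digits_shift by blast
      then have "case_nat (e 0) (shift 1 e) = case_nat k c" by (simp only: True)
      with e_eq show ?thesis by (rule disjI1[OF trans])
    next
      case False
      then have e0: "e 0 = Suc k" using ge le by simp
      then have "val (shift 1 e) = b" using eq ab by simp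
      then have "shift 1 e = d" using d(3) e(1) digits_shift by blast
      then have "case_nat (e 0) (shift 1 e) = case_nat (Suc k) d" by (simp only: e0)
      with e_eq show ?thesis by (rule disjI2[OF trans])
    qed
  qed
  have "{e. digits m e \<and> val e = x} = {case_nat k c, case_nat (Suc k) d}"
  proof (intro set_eqI iffI)
    show "z \<in> {case_nat k c, case_nat (Suc k) d}" if "z \<in> {e. digits m e \<and> val e = x}" for z
      using only[of z] that by simp
    show "z \<in> {e. digits m e \<and> val e = x}" if "z \<in> {case_nat k c, case_nat (Suc k) d}" for z
      using dig vals that by auto
  qed
  moreover have "case_nat k c \<noteq> case_nat (Suc k) d"
  proof
    assume eq: "case_nat k c = case_nat (Suc k) d"
    from fun_cong[OF eq, of 0] show False by simp
  qed
  ultimately have "card {e. is_expansion m q x e} = 2" by (simp add: is_expansion_iff)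
  moreover have "x \<in> I_q m q"
    unfolding I_q_eq using val_nonneg[OF dig(1)] val_le_M[OF dig(1)] vals(1) by simp
  ultimately show ?thesis
    unfolding B2_def using q_gt_1 q_le by auto
qed

text \<open>With \<open>k = 0\<close> no smaller first digit exists, so \<open>b < 1\<close>
  suffices; with \<open>k = m - 1\<close> no larger one exists, so \<open>M < a + 1\<close>
  suffices. If both fail, \<open>M\<close> is so large that \<open>U_q\<close> lies in
  \<open>{0, M}\<close>, but \<open>a\<close> is strictly between 0 and \<open>M\<close>.\<close>

lemma diff_set_imp_B2:
  assumes "1 \<in> diff_set (U_q m q) (U_q m q)"
  shows "q \<in> B2 m"
proof -
  obtain a b where a: "a \<in> U_q m q" and b: "b \<in> U_q m q" and ab: "a - b = 1"
    using assms unfolding diff_set_def by force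
  consider "b < 1" | "M < a + 1" | "1 \<le> b" "a + 1 \<le> M" by linarith
  then show ?thesis
  proof cases
    case 1
    then show ?thesis using B2_of_difference[OF a b ab, of 0] m_pos by simp
  next
    case 2
    then show ?thesis using B2_of_difference[OF a b ab, of "m - 1"] m_pos by simp
  next
    case 3
    then have "U_q m q \<subseteq> {0, M}" using ab by (intro U_subset_endpoints_small) simp
    then show ?thesis using a b ab 3 by auto
  qed
qed

text \<open>For the golden base \<open>U_q\<close>, and with it its closure, lies in the closed set
  \<open>{0, M}\<close>; the difference 1 would require \<open>M = 1\<close>, contrary to
  \<open>q < m + 1\<close>.\<close>

lemma closure_diff_set_imp_not_golden:
  assumes q: "q < real m + 1" and "1 \<in> diff_set (closure (U_q m q)) (closure (U_q m q))"
  shows "q \<noteq> golden m"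
proof
  assume "q = golden m"
  then have "closure (U_q m q) \<subseteq> {0, M}"
    using U_subset_endpoints_golden by (intro closure_minimal) auto
  moreover obtain a b where "a \<in> closure (U_q m q)" "b \<in> closure (U_q m q)" "a - b = 1"
    using assms(2) unfolding diff_set_def by force
  ultimately have "a = 0 \<or> a = M" "b = 0 \<or> b = M" "a - b = 1" by blast+
  then show False using M_gt_1[OF q] by auto
qed

end

section \<open>Assembly of the equivalences\<close>

lemma diff_set_mono: "A \<subseteq> B \<Longrightarrow> diff_set A A \<subseteq> diff_set B B"
  unfolding diff_set_def by blast

text \<open>Secures the second half of (iv) in the extreme base \<open>q = m + 1\<close>.\<close>

lemma golden_less: "1 \<le> m \<Longrightarrow> golden m < real m + 1"
proof (cases "even m")
  case True
  assume "1 \<le> m"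
  with True obtain k where k: "m = 2 * k" "1 \<le> k" by auto
  then show ?thesis by (simp add: golden_even)
next
  case False
  then obtain k where k: "m = 2 * k + 1" by (blast elim: oddE)
  have "(real k)\<^sup>2 + 6 * real k + 5 < (3 * real k + 3)\<^sup>2"
    by (simp add: power2_eq_square algebra_simps add_pos_nonneg)
  then have "sqrt ((real k)\<^sup>2 + 6 * real k + 5) < 3 * real k + 3"
    by (intro real_less_lsqrt) auto
  then show ?thesis
    unfolding golden_def Let_def k by simp
qed

theorem theorem1p1:
  fixes m :: nat and q :: real
  assumes "m \<ge> 1" and "q \<in> {1 <.. real m + 1}"
  shows "(q \<in> B2 m \<longleftrightarrow> 1 \<in> diff_set (U_q m q) (U_q m q)) \<and>
         (1 \<in> diff_set (U_q m q) (U_q m q) \<longleftrightarrow>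
            1 \<in> diff_set (closure (U_q m q)) (closure (U_q m q))) \<and>
         (1 \<in> diff_set (closure (U_q m q)) (closure (U_q m q)) \<longleftrightarrow>
            1 \<in> diff_set (V_q m q) (V_q m q) \<and> q \<noteq> golden m)"
proof -
  interpret expansion_base m q
    using assms by unfold_locales auto
  have i_ii: "q \<in> B2 m \<longleftrightarrow> 1 \<in> diff_set (U_q m q) (U_q m q)"
    using B2_imp_diff_set diff_set_imp_B2 by blast
  have UC: "diff_set (U_q m q) (U_q m q) \<subseteq> diff_set (closure (U_q m q)) (closure (U_q m q))"
    by (intro diff_set_mono closure_subset)
  have CV: "diff_set (closure (U_q m q)) (closure (U_q m q)) \<subseteq> diff_set (V_q m q) (V_q m q)"
    by (intro diff_set_mono closure_U_subset_V)
  show ?thesis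
  proof (cases "q < real m + 1")
    case True
    then show ?thesis
      using i_ii UC CV diff_set_V_imp_diff_set_U closure_diff_set_imp_not_golden by blast
  next
    case False
    \<comment> \<open>In the base \<open>m + 1\<close> the interval \<open>I_q\<close> is
      \<open>[0, 1]\<close>, and its endpoints, both in \<open>U_q\<close>, already differ by
      1.\<close>
    then have q: "q = real m + 1" using q_le by simp
    then have "M = 1" unfolding top_val_def using assms(1) by simp
    then have "1 \<in> diff_set (U_q m q) (U_q m q)"
      unfolding diff_set_def using zero_in_U M_in_U by force
    moreover have "q \<noteq> golden m" using golden_less[OF assms(1)] q by simp
    ultimately show ?thesis using i_ii UC CV by blast
  qed
qed

end
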